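(* Let $\Sigma\subset\mathbb P^{n+3}$ be the ruled hypersurface of a system of $n$ conservation laws $u^i_t=\frac{d}{dx}f^i(u)$, $i=1,\dots,n$, admitting two additional independent conservation laws. Suppose that 1) $\Sigma$ is not ruled by projective spaces of any dimension $r>1$; 2) the projective tangent spaces of $\Sigma$ are not concurrent (they do not all pass through a common point). Then the dual hypersurface $\Sigma^*\subset(\mathbb P^{n+3})^*$ is of codimension 2, it is not contained in a proper projective subspace of $(\mathbb P^{n+3})^*$, and its projective tangent spaces are stable along the line generators of $\Sigma^*$ (the projective tangent space to $\Sigma^*$ is the same at all points of a given generator).
   Context: All considerations are local and smooth, over $\mathbb R$; tangent spaces are taken at smooth points. For a system $u^i_t=\frac{d}{dx}f^i(u)$, $i=1,\dots,n$, an additional conservation law is a one-form $B(u)\,dx+A(u)\,dt$ closed on each solution $u(x,t)$; equivalently $\partial_iA=\sum_k \partial_kB\,\partial_i f^k$ for all $i$, where $\partial_i=\partial/\partial u^i$. Two additional conservation laws $B\,dx+A\,dt$, $N\,dx+M\,dt$ are independent if the $n+4$ one-forms $dx$, $dt$, $u^i\,dx+f^i(u)\,dt$ ($i=1,\dots,n$), $B\,dx+A\,dt$, $N\,dx+M\,dt$, viewed as one-forms in the space with coordinates $(u,x,t)$, are linearly independent over $\mathbb R$. The ruled hypersurface $\Sigma$ of such a system is the $(n+1)$-dimensional (codimension 2) submanifold of $\mathbb P^{n+3}$ (homogeneous coordinates $[Y^0:\dots:Y^{n+3}]$) swept out by the lines (generators), parametrized by $u$: $$Y^i=u^iY^0+f^i(u)Y^{n+3}\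 (i=1,\dots,n),\quad Y^{n+1}=B(u)Y^0+A(u)Y^{n+3},\quad Y^{n+2}=N(u)Y^0+M(u)Y^{n+3}.$$ The projective tangent spaces of $\Sigma$ are constant along each generator. The dual hypersurface $\Sigma^*$ is the set of points of the dual space $(\mathbb P^{n+3})^*$ corresponding to the hyperplanes tangent to $\Sigma$. Since $\Sigma$ has codimension 2 and its tangent spaces are constant along the generators, to each generator of $\Sigma$ (i.e. to each value of $u$) there corresponds a pencil of hyperplanes tangent to $\Sigma$ along this generator, i.e. a line in $(\mathbb P^{n+3})^*$; these lines are the line generators of $\Sigma^*$. *)

theory Defs
  imports "HOL-Analysis.Analysis"
begin

section \<open>Smooth maps\<close>

text \<open>
  The \<open>k\<close>-fold and infinite differentiability notions below are meant for open sets \<open>S\<close>, since the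
  derivatives are the unrestricted ones.
\<close>

primrec diff_on :: "nat \<Rightarrow> 'a::real_normed_vector set \<Rightarrow> ('a \<Rightarrow> 'b::real_normed_vector) \<Rightarrow> bool" where
  "diff_on 0 S f \<longleftrightarrow> continuous_on S f"
| "diff_on (Suc k) S f \<longleftrightarrow>
     (\<forall>x\<in>S. f differentiable (at x)) \<and> (\<forall>v. diff_on k S (\<lambda>x. frechet_derivative f (at x) v))"

definition smooth_on :: "'a::real_normed_vector set \<Rightarrow> ('a \<Rightarrow> 'b::real_normed_vector) \<Rightarrow> bool" where
  "smooth_on S f \<longleftrightarrow> (\<forall>k. diff_on k S f)"

definition partial :: "'n::finite \<Rightarrow> (real^'n \<Rightarrow> real) \<Rightarrow> real^'n \<Rightarrow> real" where
  "partial i g u = frechet_derivative g (at u) (axis i 1)"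


section \<open>Conservation laws\<close>

text \<open>
  \<open>B dx + A dt\<close> is closed on every solution of \<open>u\<^sub>t = f(u)\<^sub>x\<close>, expressed by the system of partial
  differential equations that \<open>A\<close> and \<open>B\<close> have to satisfy.
\<close>

definition conservation_law ::
    "(real^'n::finite) set \<Rightarrow> (real^'n \<Rightarrow> real^'n) \<Rightarrow> (real^'n \<Rightarrow> real) \<Rightarrow> (real^'n \<Rightarrow> real) \<Rightarrow> bool" where
  "conservation_law U f B A \<longleftrightarrow>
     (\<forall>u\<in>U. \<forall>i. partial i A u = (\<Sum>k\<in>UNIV. partial k B u * partial i (\<lambda>v. f v $ k) u))"

text \<open>
  The one-form \<open>b(u) dx + a(u) dt\<close> on the space with coordinates \<open>(u, x, t)\<close>: a point is sent to a
  linear functional of tangent vectors \<open>(du, dx, dt)\<close>.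
\<close>

definition one_form ::
    "(real^'n::finite \<Rightarrow> real) \<Rightarrow> (real^'n \<Rightarrow> real)
       \<Rightarrow> (real^'n) \<times> real \<times> real \<Rightarrow> (real^'n) \<times> real \<times> real \<Rightarrow> real" where
  "one_form b a = (\<lambda>(u, x, t) (du, dx, dt). b u * dx + a u * dt)"

definition independent_laws ::
    "(real^'n::finite) set \<Rightarrow> (real^'n \<Rightarrow> real^'n) \<Rightarrow> (real^'n \<Rightarrow> real) \<Rightarrow> (real^'n \<Rightarrow> real)
       \<Rightarrow> (real^'n \<Rightarrow> real) \<Rightarrow> (real^'n \<Rightarrow> real) \<Rightarrow> bool" where
  "independent_laws U f B A N M \<longleftrightarrow>
     (\<forall>p q r s (c :: real^'n).
        (\<forall>z \<in> U \<times> UNIV. \<forall>v.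
             p * one_form (\<lambda>_. 1) (\<lambda>_. 0) z v
           + q * one_form (\<lambda>_. 0) (\<lambda>_. 1) z v
           + (\<Sum>i\<in>UNIV. c $ i * one_form (\<lambda>u. u $ i) (\<lambda>u. f u $ i) z v)
           + r * one_form B A z v
           + s * one_form N M z v = 0)
        \<longrightarrow> p = 0 \<and> q = 0 \<and> c = 0 \<and> r = 0 \<and> s = 0)"


section \<open>Ruled submanifolds of projective space\<close>

text \<open>
  Homogeneous coordinates \<open>(Y\<^sup>0, (Y\<^sup>1, \<dots>, Y\<^sup>n), Y\<^sup>n\<^sup>+\<^sup>1, Y\<^sup>n\<^sup>+\<^sup>2, Y\<^sup>n\<^sup>+\<^sup>3)\<close>. Points of the projective space are
  nonzero vectors up to scaling, and projective subspaces of dimension \<open>r\<close> are linear subspaces of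
  dimension \<open>r + 1\<close>. The same type carries the homogeneous coordinates of the dual space, where
  \<open>z\<close> stands for the hyperplane \<open>{y. z \<bullet> y = 0}\<close>.
\<close>

type_synonym 'n hcoords = "real \<times> (real^'n) \<times> real \<times> real \<times> real"

text \<open>
  A submanifold swept out by lines is described by the map sending \<open>(u, s, t)\<close> to the point with
  homogeneous parameters \<open>(s, t)\<close> on the generator of \<open>u\<close>. Its cone has dimension \<open>n + 2\<close>, that is,
  the submanifold has dimension \<open>n + 1\<close> and codimension 2, where the derivative of this map is
  injective.
\<close>

type_synonym 'n sweep = "(real^'n) \<times> real \<times> real \<Rightarrow> 'n hcoords"

definition ruled_hypersurface ::
    "(real^'n::finite \<Rightarrow> real^'n) \<Rightarrow> (real^'n \<Rightarrow> real) \<Rightarrow> (real^'n \<Rightarrow> real)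
       \<Rightarrow> (real^'n \<Rightarrow> real) \<Rightarrow> (real^'n \<Rightarrow> real) \<Rightarrow> 'n sweep" where
  "ruled_hypersurface f B A N M =
     (\<lambda>(u, s, t). (s, s *\<^sub>R u + t *\<^sub>R f u, B u * s + A u * t, N u * s + M u * t, t))"

definition line_sweep ::
    "(real^'n::finite \<Rightarrow> 'n hcoords) \<Rightarrow> (real^'n \<Rightarrow> 'n hcoords) \<Rightarrow> 'n sweep" where
  "line_sweep X W = (\<lambda>(u, s, t). s *\<^sub>R X u + t *\<^sub>R W u)"

text \<open>
  For \<open>(s, t) = (0, 0)\<close>, which is not a point of the projective line, the derivative in \<open>u\<close> vanishes;
  so such parameters are never smooth points.
\<close>

definition smooth_point :: "'n::finite sweep \<Rightarrow> (real^'n) \<times> real \<times> real \<Rightarrow> bool" where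
  "smooth_point Y p \<longleftrightarrow> inj (frechet_derivative Y (at p))"

definition smooth_points ::
    "(real^'n::finite) set \<Rightarrow> 'n sweep \<Rightarrow> ((real^'n) \<times> real \<times> real) set" where
  "smooth_points U Y = {p \<in> U \<times> UNIV. smooth_point Y p}"

text \<open>
  The linear space over the projective tangent space at a smooth point. It contains the point
  itself, since the map is linear in \<open>(s, t)\<close>.
\<close>

definition tangent_space :: "'n::finite sweep \<Rightarrow> (real^'n) \<times> real \<times> real \<Rightarrow> 'n hcoords set" where
  "tangent_space Y p = range (frechet_derivative Y (at p))"

definition tangent_spaces_concurrent :: "(real^'n::finite) set \<Rightarrow> 'n sweep \<Rightarrow> bool" where
  "tangent_spaces_concurrent U Y \<longleftrightarrow>
     (\<exists>y. y \<noteq> 0 \<and> (\<forall>p \<in> smooth_points U Y. y \<in> tangent_space Y p))"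

definition stable_along_generators :: "(real^'n::finite) set \<Rightarrow> 'n sweep \<Rightarrow> bool" where
  "stable_along_generators U Y \<longleftrightarrow>
     (\<forall>u s t s' t'. (u, s, t) \<in> smooth_points U Y \<and> (u, s', t') \<in> smooth_points U Y
        \<longrightarrow> tangent_space Y (u, s, t) = tangent_space Y (u, s', t'))"

text \<open>
  The submanifold is swept out by a smooth family of projective subspaces of dimension \<open>r\<close>: to every
  smooth point \<open>p\<close> is attached such a subspace \<open>L p\<close> through it, depending smoothly on \<open>p\<close>, that near
  the point lies in the submanifold and is the subspace attached to its points there.
\<close>

definition ruled_by_projective_spaces :: "nat \<Rightarrow> (real^'n::finite) set \<Rightarrow> 'n sweep \<Rightarrow> bool" where
  "ruled_by_projective_spaces r U Y \<longleftrightarrow>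
     (\<exists>L. \<forall>p \<in> smooth_points U Y.
        subspace (L p) \<and> dim (L p) = r + 1 \<and> Y p \<in> L p
      \<and> (\<exists>G e. open G \<and> p \<in> G \<and> (\<forall>j\<le>r. smooth_on (G \<inter> smooth_points U Y) (e j))
           \<and> (\<forall>q \<in> G \<inter> smooth_points U Y. L q = span ((\<lambda>j. e j q) ` {..r})))
      \<and> (\<exists>G. open G \<and> Y p \<in> G
           \<and> (\<forall>y \<in> G \<inter> L p. \<exists>q \<in> smooth_points U Y. Y q = y \<and> L q = L p)))"


section \<open>The dual hypersurface\<close>

definition tangent_hyperplane_at ::
    "'n::finite sweep \<Rightarrow> (real^'n) \<times> real \<times> real \<Rightarrow> 'n hcoords \<Rightarrow> bool" where
  "tangent_hyperplane_at Y p z \<longleftrightarrow> z \<noteq> 0 \<and> tangent_space Y p \<subseteq> {y. z \<bullet> y = 0}"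

definition dual_hypersurface :: "(real^'n::finite) set \<Rightarrow> 'n sweep \<Rightarrow> 'n hcoords set" where
  "dual_hypersurface U Y = {z. \<exists>p \<in> smooth_points U Y. tangent_hyperplane_at Y p z}"

definition tangent_pencil ::
    "(real^'n::finite) set \<Rightarrow> 'n sweep \<Rightarrow> real^'n \<Rightarrow> 'n hcoords set" where
  "tangent_pencil U Y u =
     {z. \<forall>s t. (u, s, t) \<in> smooth_points U Y \<longrightarrow> tangent_hyperplane_at Y (u, s, t) z}"

text \<open>
  \<open>X u\<close> and \<open>W u\<close> span the line of the dual space formed by the hyperplanes tangent along the
  generator of \<open>u\<close>, and the dual hypersurface is swept out by these lines.
\<close>

definition dual_generators ::
    "(real^'n::finite) set \<Rightarrow> 'n sweep \<Rightarrow> (real^'n \<Rightarrow> 'n hcoords) \<Rightarrow> (real^'n \<Rightarrow> 'n hcoords) \<Rightarrow> bool" where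
  "dual_generators U Y X W \<longleftrightarrow>
     smooth_on U X \<and> smooth_on U W
   \<and> (\<forall>u\<in>U. dim (span {X u, W u}) = 2 \<and> tangent_pencil U Y u = span {X u, W u} - {0})
   \<and> dual_hypersurface U Y = (\<Union>u\<in>U. span {X u, W u} - {0})"

text \<open>
  Codimension 2 of a submanifold swept out by lines: its smooth points, where it has dimension
  \<open>n + 1\<close>, are dense.
\<close>

definition codimension_two :: "(real^'n::finite) set \<Rightarrow> 'n sweep \<Rightarrow> bool" where
  "codimension_two U Y \<longleftrightarrow> U \<times> UNIV \<subseteq> closure (smooth_points U Y)"

end

theory Submission
  imports Defs
begin

text \<open>
  The hyperplanes tangent along the generator of \<open>u\<close> are spanned by the conormals \<open>X u\<close> and \<open>W u\<close> of
  the two conservation laws, and a vector orthogonal to all of them lies in every tangent space: this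
  is the nondegeneracy of the dual. Differentiating, the tangent space of the dual at \<open>s X + t W\<close> is
  spanned by \<open>X\<close>, \<open>W\<close> and the vectors \<open>(u \<bullet> g, -g, 0, 0, f \<bullet> g)\<close> with \<open>g\<close> in the image of the Hessian of
  \<open>s B + t N\<close>; where this Hessian is invertible, it does not depend on \<open>(s, t)\<close>.

  If the Hessian were singular for all \<open>(u, s, t)\<close> in an open set, fix \<open>C = s\<^sub>0 B + t\<^sub>0 N\<close> with Hessian of
  locally largest rank. Maximality of the rank makes the third derivative of \<open>C\<close> and the Hessians of
  \<open>B\<close> and \<open>N\<close> vanish on the kernel \<open>K\<close>. Hence \<open>K\<close> is constant along the affine leaves \<open>u + K u\<close> (a
  Gronwall argument, as for surfaces of zero curvature). The product of this Hessian with the derivative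
  of \<open>f\<close> is symmetric, so the latter preserves \<open>K\<close>. It follows that \<open>B\<close> and \<open>N\<close> are affine along a leaf, and the
  generators over it fill an open part of a projective space of dimension \<open>dim K + 1 > 1\<close>.
\<close>

section \<open>Calculus of smooth maps\<close>

abbreviation fd :: "('a::real_normed_vector \<Rightarrow> 'b::real_normed_vector) \<Rightarrow> 'a \<Rightarrow> 'a \<Rightarrow> 'b" where
  "fd F x \<equiv> frechet_derivative F (at x)"

lemma fd_eq: "(F has_derivative F') (at x) \<Longrightarrow> fd F x v = F' v"
  using frechet_derivative_at by fastforce

section \<open>Rules for finitely often differentiable maps on open sets\<close>

lemma diff_on_Suc_imp: "diff_on (Suc k) S F \<Longrightarrow> diff_on k S F"
proof (induction k arbitrary: F)
  case 0
  then show ?case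
    by (auto simp: continuous_at_imp_continuous_on differentiable_imp_continuous_within)
qed auto

lemma diff_on_subset: "diff_on k S F \<Longrightarrow> T \<subseteq> S \<Longrightarrow> diff_on k T F"
  by (induction k arbitrary: F) (auto intro: continuous_on_subset)

text \<open>The derivatives in \<open>diff_on\<close> are unrestricted; at a point of an open set
  they depend only on values in the set, hence \<open>open S\<close>.\<close>

lemma diff_on_cong:
  assumes "open S" "\<And>x. x \<in> S \<Longrightarrow> F x = G x" "diff_on k S F"
  shows "diff_on k S G"
  using assms(2,3)
proof (induction k arbitrary: F G)
  case 0
  then show ?case by (metis continuous_on_cong diff_on.simps(1))
next
  case (Suc k)
  have *: "(G has_derivative fd F x) (at x)" if "x \<in> S" for x
    using Suc.prems that \<open>open S\<close> frechet_derivative_works has_derivative_transform_within_open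
    by (metis diff_on.simps(2))
  then have "fd G x = fd F x" if "x \<in> S" for x
    using that frechet_derivative_at by metis
  then have "diff_on k S (\<lambda>x. fd G x v)" for v
    using Suc.prems(2) by (intro Suc.IH[of "\<lambda>x. fd F x v" "\<lambda>x. fd G x v"]) simp_all
  then show ?case
    using * by (auto intro: differentiableI)
qed

lemma diff_on_SucI:
  assumes "open S" "\<And>x. x \<in> S \<Longrightarrow> (F has_derivative F' x) (at x)" "\<And>v. diff_on k S (\<lambda>x. F' x v)"
  shows "diff_on (Suc k) S F"
proof -
  have "diff_on k S (\<lambda>x. fd F x v)" for v
    using assms(2) by (intro diff_on_cong[OF assms(1) _ assms(3)[of v]]) (metis fd_eq)
  then show ?thesis
    using assms(2) by (auto intro: differentiableI)
qed

lemma diff_on_Suc_has_derivative: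
  "diff_on (Suc k) S F \<Longrightarrow> x \<in> S \<Longrightarrow> (F has_derivative fd F x) (at x)"
  using frechet_derivative_works by auto

lemma diff_on_const: "diff_on k S (\<lambda>_. c)"
  by (induction k arbitrary: c) auto

lemma diff_on_bounded_linear:
  assumes "open S" "bounded_linear h" "diff_on k S F"
  shows "diff_on k S (\<lambda>x. h (F x))"
  using assms(3)
proof (induction k arbitrary: F)
  case 0
  then show ?case by (simp add: assms(2) bounded_linear.continuous_on)
next
  case (Suc k)
  have "diff_on k S (\<lambda>x. h (fd F x v))" for v
    using Suc.prems by (intro Suc.IH) simp
  with bounded_linear.has_derivative[OF assms(2) diff_on_Suc_has_derivative[OF Suc.prems]] show ?case
    by (rule diff_on_SucI[OF assms(1)])
qed

text \<open>The derivative of \<open>F (c + h x)\<close> in direction \<open>v\<close> has the same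
  shape, with \<open>fd F _ (h v)\<close> in place of \<open>F\<close>, so an induction over all
  \<open>F\<close> closes without a higher-order chain rule.\<close>

lemma diff_on_compose_affine:
  assumes "open S" "bounded_linear h" "diff_on k T F" "\<And>x. x \<in> S \<Longrightarrow> c + h x \<in> T"
  shows "diff_on k S (\<lambda>x. F (c + h x))"
  using assms(3)
proof (induction k arbitrary: F)
  case 0
  have "continuous_on S (\<lambda>x. c + h x)"
    by (intro continuous_intros linear_continuous_on assms)
  then show ?case
    using 0 assms(4) by (auto intro: continuous_on_compose2)
next
  case (Suc k)
  have "((\<lambda>x. F (c + h x)) has_derivative (\<lambda>v. fd F (c + h x) (h v))) (at x)" if "x \<in> S" for x
  proof -
    have "((\<lambda>x. c + h x) has_derivative h) (at x)"
      using assms(2) by (auto intro!: derivative_eq_intros bounded_linear_imp_has_derivative)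
    from diff_chain_at[OF this diff_on_Suc_has_derivative[OF Suc.prems]] show ?thesis
      using that assms(4) by (simp add: o_def)
  qed
  moreover have "diff_on k S (\<lambda>x. fd F (c + h x) (h v))" for v
    using Suc.prems by (intro Suc.IH) simp
  ultimately show ?case
    by (rule diff_on_SucI[OF assms(1)])
qed

lemma diff_on_add:
  assumes "open S" "diff_on k S F" "diff_on k S G"
  shows "diff_on k S (\<lambda>x. F x + G x)"
  using assms(2,3)
proof (induction k arbitrary: F G)
  case (Suc k)
  have "diff_on k S (\<lambda>x. fd F x v + fd G x v)" for v
    using Suc.prems by (intro Suc.IH) simp_all
  with has_derivative_add[OF diff_on_Suc_has_derivative[OF Suc.prems(1)]
      diff_on_Suc_has_derivative[OF Suc.prems(2)]] show ?case
    by (rule diff_on_SucI[OF assms(1)])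
qed (auto intro: continuous_on_add)

lemma diff_on_bilinear:
  assumes "open S" "bounded_bilinear bop" "diff_on k S F" "diff_on k S G"
  shows "diff_on k S (\<lambda>x. bop (F x) (G x))"
  using assms(3,4)
proof (induction k arbitrary: F G)
  case 0
  then show ?case by (simp add: assms(2) bounded_bilinear.continuous_on)
next
  case (Suc k)
  note dF = diff_on_Suc_imp[OF Suc.prems(1)] and dG = diff_on_Suc_imp[OF Suc.prems(2)]
  have "diff_on k S (\<lambda>x. bop (F x) (fd G x v))" "diff_on k S (\<lambda>x. bop (fd F x v) (G x))" for v
    using Suc.prems by (auto intro!: Suc.IH dF dG)
  with bounded_bilinear.FDERIV[OF assms(2) diff_on_Suc_has_derivative[OF Suc.prems(1)]
      diff_on_Suc_has_derivative[OF Suc.prems(2)]] diff_on_add[OF assms(1) this] show ?case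
    by (intro diff_on_SucI[OF assms(1)])
qed

text \<open>The derivative of a reciprocal is a product of that reciprocal, twice, and
  \<open>fd F\<close>, so \<open>F\<close> stays fixed and the hypothesis is reused one order
  lower.\<close>

lemma diff_on_inverse:
  fixes F :: "'a::real_normed_vector \<Rightarrow> real"
  assumes "open S" "diff_on k S F" "\<And>x. x \<in> S \<Longrightarrow> F x \<noteq> 0"
  shows "diff_on k S (\<lambda>x. inverse (F x))"
  using assms(2)
proof (induction k)
  case 0
  then show ?case using assms(3) by (auto intro: continuous_on_inverse)
next
  case (Suc k)
  note IH = Suc.IH[OF diff_on_Suc_imp[OF Suc.prems]]
  have "diff_on k S (\<lambda>x. - (inverse (F x) * fd F x v * inverse (F x)))" for v
    using Suc.prems
    by (intro diff_on_bounded_linear[OF assms(1) bounded_linear_minus[OF bounded_linear_ident]]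
        diff_on_bilinear[OF assms(1) bounded_bilinear_mult] IH) simp
  with Deriv.has_derivative_inverse[OF assms(3) diff_on_Suc_has_derivative[OF Suc.prems]] show ?case
    by (rule diff_on_SucI[OF assms(1)])
qed

section \<open>Closure properties of smooth maps\<close>

lemma smooth_on_subset: "smooth_on S F \<Longrightarrow> T \<subseteq> S \<Longrightarrow> smooth_on T F"
  unfolding smooth_on_def using diff_on_subset by blast

lemma smooth_on_const: "smooth_on S (\<lambda>_. c)"
  by (simp add: smooth_on_def diff_on_const)

lemma smooth_on_linear: "open S \<Longrightarrow> bounded_linear h \<Longrightarrow> smooth_on S F \<Longrightarrow> smooth_on S (\<lambda>x. h (F x))"
  by (simp add: smooth_on_def diff_on_bounded_linear)

lemma smooth_on_compose_affine:
  "open S \<Longrightarrow> bounded_linear h \<Longrightarrow> smooth_on T F \<Longrightarrow> (\<And>x. x \<in> S \<Longrightarrow> c + h x \<in> T)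
    \<Longrightarrow> smooth_on S (\<lambda>x. F (c + h x))"
  unfolding smooth_on_def using diff_on_compose_affine by blast

lemma smooth_on_compose_linear:
  "open S \<Longrightarrow> bounded_linear h \<Longrightarrow> smooth_on T F \<Longrightarrow> (\<And>x. x \<in> S \<Longrightarrow> h x \<in> T)
    \<Longrightarrow> smooth_on S (\<lambda>x. F (h x))"
  using smooth_on_compose_affine[where c = 0] by force

lemma smooth_on_ident: "smooth_on S (\<lambda>x. x)"
proof -
  have "diff_on k S (\<lambda>x. x)" for k
    by (cases k) (auto simp: diff_on_const)
  then show ?thesis by (simp add: smooth_on_def)
qed

lemma smooth_on_add:
  "open S \<Longrightarrow> smooth_on S F \<Longrightarrow> smooth_on S G \<Longrightarrow> smooth_on S (\<lambda>x. F x + G x)"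
  by (simp add: smooth_on_def diff_on_add)

lemma smooth_on_bilinear:
  "open S \<Longrightarrow> bounded_bilinear bop \<Longrightarrow> smooth_on S F \<Longrightarrow> smooth_on S G
    \<Longrightarrow> smooth_on S (\<lambda>x. bop (F x) (G x))"
  by (simp add: smooth_on_def diff_on_bilinear)

lemmas smooth_on_mult = smooth_on_bilinear[OF _ bounded_bilinear_mult]
lemmas smooth_on_scaleR = smooth_on_bilinear[OF _ bounded_bilinear_scaleR]
lemmas smooth_on_inner = smooth_on_bilinear[OF _ bounded_bilinear_inner]

lemma smooth_on_minus: "open S \<Longrightarrow> smooth_on S F \<Longrightarrow> smooth_on S (\<lambda>x. - F x)"
  by (rule smooth_on_linear[OF _ bounded_linear_minus[OF bounded_linear_ident]])

lemma smooth_on_diff: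
  "open S \<Longrightarrow> smooth_on S F \<Longrightarrow> smooth_on S G \<Longrightarrow> smooth_on S (\<lambda>x. F x - G x)"
  using smooth_on_add[OF _ _ smooth_on_minus] by fastforce

lemma smooth_on_sum:
  "open S \<Longrightarrow> (\<And>i. i \<in> I \<Longrightarrow> smooth_on S (F i)) \<Longrightarrow> smooth_on S (\<lambda>x. \<Sum>i\<in>I. F i x)"
  by (induction I rule: infinite_finite_induct) (auto simp: smooth_on_const intro: smooth_on_add)

lemma smooth_on_prod:
  fixes F :: "'i \<Rightarrow> 'a::real_normed_vector \<Rightarrow> real"
  shows "open S \<Longrightarrow> (\<And>i. i \<in> I \<Longrightarrow> smooth_on S (F i)) \<Longrightarrow> smooth_on S (\<lambda>x. \<Prod>i\<in>I. F i x)"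
  by (induction I rule: infinite_finite_induct) (auto simp: smooth_on_const intro: smooth_on_mult)

lemma smooth_on_inverse:
  fixes F :: "'a::real_normed_vector \<Rightarrow> real"
  shows "open S \<Longrightarrow> smooth_on S F \<Longrightarrow> (\<And>x. x \<in> S \<Longrightarrow> F x \<noteq> 0) \<Longrightarrow> smooth_on S (\<lambda>x. inverse (F x))"
  by (simp add: smooth_on_def diff_on_inverse)

lemma smooth_on_Pair:
  assumes "open S" "smooth_on S F" "smooth_on S G"
  shows "smooth_on S (\<lambda>x. (F x, G x))"
proof -
  have "smooth_on S (\<lambda>x. (F x, 0) + (0, G x))"
    by (intro smooth_on_add smooth_on_linear[where h = "\<lambda>y. (y, 0)"]
        smooth_on_linear[where h = "\<lambda>y. (0, y)"] assms bounded_linear_Pair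
        bounded_linear_ident bounded_linear_zero)
  then show ?thesis by simp
qed

lemma bounded_linear_axis: "bounded_linear (axis i :: 'a::real_normed_vector \<Rightarrow> 'a^'n::finite)"
  by (rule bounded_linear_intro[where K = 1]) (auto simp: axis_def vec_eq_iff norm_vec_def L2_set_def if_distrib[of norm] if_distrib[of "\<lambda>x. x\<^sup>2"] cong: if_cong)

lemma smooth_on_vec_lambda:
  fixes F :: "'a::real_normed_vector \<Rightarrow> 'n::finite \<Rightarrow> 'b::real_normed_vector"
  assumes "open S" "\<And>i. smooth_on S (\<lambda>x. F x i)"
  shows "smooth_on S (\<lambda>x. \<chi> i. F x i)"
proof -
  have "smooth_on S (\<lambda>x. \<Sum>i\<in>UNIV. axis i (F x i))"
    by (intro smooth_on_sum smooth_on_linear[OF _ bounded_linear_axis] assms)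
  moreover have "(\<chi> i. F x i) = (\<Sum>i\<in>UNIV. axis i (F x i))" for x
    by (simp add: vec_eq_iff axis_def if_distrib cong: if_cong)
  ultimately show ?thesis by simp
qed

lemma smooth_on_vec_nth: "open S \<Longrightarrow> smooth_on S F \<Longrightarrow> smooth_on S (\<lambda>x. F x $ i)"
  by (rule smooth_on_linear[OF _ bounded_linear_vec_nth])

lemma smooth_on_fd: "smooth_on S F \<Longrightarrow> smooth_on S (\<lambda>x. fd F x v)"
  unfolding smooth_on_def using diff_on.simps(2) by blast

lemma smooth_on_has_derivative: "smooth_on S F \<Longrightarrow> x \<in> S \<Longrightarrow> (F has_derivative fd F x) (at x)"
  unfolding smooth_on_def using diff_on_Suc_has_derivative by blast

lemma smooth_on_continuous: "smooth_on S F \<Longrightarrow> continuous_on S F"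
  unfolding smooth_on_def using diff_on.simps(1) by blast

lemma smooth_on_isCont: "open S \<Longrightarrow> smooth_on S F \<Longrightarrow> x \<in> S \<Longrightarrow> isCont F x"
  using smooth_on_continuous continuous_on_eq_continuous_at by blast

lemma fd_linear: "smooth_on S F \<Longrightarrow> x \<in> S \<Longrightarrow> linear (fd F x)"
  using smooth_on_has_derivative has_derivative_linear by blast

section \<open>Matrix-valued smooth maps\<close>

lemma bounded_bilinear_matrix_vector:
  "bounded_bilinear ((*v) :: real^'n::finite^'m::finite \<Rightarrow> real^'n \<Rightarrow> real^'m)"
  unfolding bilinear_conv_bounded_bilinear[symmetric] bilinear_def
  by (auto simp: linear_iff matrix_vector_mult_add_rdistrib matrix_vector_right_distrib
      scaleR_matrix_vector_assoc matrix_vector_mult_scaleR)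

lemmas smooth_on_matrix_vector = smooth_on_bilinear[OF _ bounded_bilinear_matrix_vector]

lemma smooth_on_det:
  fixes H :: "'a::real_normed_vector \<Rightarrow> real^'n::finite^'n"
  assumes "open S" "\<And>i j. smooth_on S (\<lambda>x. H x $ i $ j)"
  shows "smooth_on S (\<lambda>x. det (H x))"
  unfolding det_def
  by (intro smooth_on_sum smooth_on_mult smooth_on_prod smooth_on_const assms)

text \<open>Cramer's rule: the entries of the inverse are determinants in the entries of
  \<open>H\<close>, divided by \<open>det H\<close>.\<close>

lemma smooth_on_matrix_inv:
  fixes H :: "'a::real_normed_vector \<Rightarrow> real^'n::finite^'n"
  assumes "open S" "smooth_on S H" "\<And>x. x \<in> S \<Longrightarrow> det (H x) \<noteq> 0"
  obtains R where "smooth_on S R" "\<And>x. x \<in> S \<Longrightarrow> R x ** H x = mat 1"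
    "\<And>x. x \<in> S \<Longrightarrow> H x ** R x = mat 1"
proof -
  define R where "R x = (\<chi> k l. det (\<chi> i j. if j = k then (axis l 1 :: real^'n) $ i else H x $ i $ j) * inverse (det (H x)))" for x
  have Hs: "smooth_on S (\<lambda>x. H x $ i $ j)" for i j
    by (intro smooth_on_vec_nth assms)
  have "smooth_on S (\<lambda>x. if j = k then (axis l 1 :: real^'n) $ i else H x $ i $ j)" for i j k l
    by (cases "j = k") (auto simp: Hs smooth_on_const)
  then have "smooth_on S R"
    unfolding R_def
    by (intro smooth_on_vec_lambda smooth_on_mult smooth_on_inverse smooth_on_det assms Hs) auto
  moreover have HR: "H x ** R x = mat 1" if "x \<in> S" for x
  proof -
    have "H x *v column l (R x) = axis l 1" for l
      by (subst cramer[OF assms(3)[OF that]]) (simp add: column_def R_def field_class.field_divide_inverse)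
    then show ?thesis
      by (simp add: column_def mat_def axis_def vec_eq_iff matrix_matrix_mult_def matrix_vector_mult_def)
  qed
  moreover have "R x ** H x = mat 1" if "x \<in> S" for x
    using HR[OF that] matrix_left_right_inverse by blast
  ultimately show ?thesis using that by blast
qed

section \<open>Symmetry of second derivatives\<close>

lemma second_difference:
  fixes g :: "'a::real_normed_vector \<Rightarrow> real"
  assumes g: "smooth_on S g" and h: "h > 0"
    and S: "\<And>a b. 0 \<le> a \<Longrightarrow> a \<le> h \<Longrightarrow> 0 \<le> b \<Longrightarrow> b \<le> h \<Longrightarrow> u + a *\<^sub>R v + b *\<^sub>R w \<in> S"
  obtains a b where "0 \<le> a" "a \<le> h" "0 \<le> b" "b \<le> h"
    "g (u + h *\<^sub>R v + h *\<^sub>R w) - g (u + h *\<^sub>R v) - (g (u + h *\<^sub>R w) - g u)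
      = h * h * fd (\<lambda>x. fd g x v) (u + a *\<^sub>R v + b *\<^sub>R w) w"
proof -
  have line: "((\<lambda>a. G (p + a *\<^sub>R d)) has_real_derivative fd G (p + a *\<^sub>R d) d) (at a)"
    if "smooth_on S G" "p + a *\<^sub>R d \<in> S" for G :: "'a \<Rightarrow> real" and p d a
  proof -
    have "((\<lambda>a. p + a *\<^sub>R d) has_derivative (\<lambda>c. c *\<^sub>R d)) (at a)"
      by (auto intro!: derivative_eq_intros)
    from diff_chain_at[OF this smooth_on_has_derivative[OF that]]
    show ?thesis
      unfolding has_field_derivative_def o_def
      by (rule has_derivative_eq_rhs)
         (simp add: fun_eq_iff linear_scale[OF fd_linear[OF that]])
  qed
  \<comment> \<open>The mean value theorem is used twice: in direction \<open>v\<close> for the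
    increment along \<open>w\<close>, then in direction \<open>w\<close> for the derivative along
    \<open>v\<close>.\<close>
  have "\<exists>a>0. a < h \<and> (g ((u + h *\<^sub>R w) + h *\<^sub>R v) - g (u + h *\<^sub>R v)) - (g ((u + h *\<^sub>R w) + 0 *\<^sub>R v) - g (u + 0 *\<^sub>R v))
      = (h - 0) * (fd g ((u + h *\<^sub>R w) + a *\<^sub>R v) v - fd g (u + a *\<^sub>R v) v)"
    using h S[of _ h] S[of _ 0]
    by (intro MVT2[OF h, where f = "\<lambda>a. g ((u + h *\<^sub>R w) + a *\<^sub>R v) - g (u + a *\<^sub>R v)"] DERIV_diff line g)
       (auto simp: algebra_simps)
  then obtain a where a: "0 < a" "a < h" and
    1: "(g ((u + h *\<^sub>R w) + h *\<^sub>R v) - g (u + h *\<^sub>R v)) - (g (u + h *\<^sub>R w) - g u)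
      = h * (fd g ((u + h *\<^sub>R w) + a *\<^sub>R v) v - fd g (u + a *\<^sub>R v) v)"
    by auto
  have "\<exists>b>0. b < h \<and> fd g ((u + a *\<^sub>R v) + h *\<^sub>R w) v - fd g ((u + a *\<^sub>R v) + 0 *\<^sub>R w) v
      = (h - 0) * fd (\<lambda>x. fd g x v) ((u + a *\<^sub>R v) + b *\<^sub>R w) w"
    using S[of a] a
    by (intro MVT2[OF h, where f = "\<lambda>b. fd g ((u + a *\<^sub>R v) + b *\<^sub>R w) v"] line smooth_on_fd g) auto
  then obtain b where "0 < b" "b < h" and
    "fd g ((u + a *\<^sub>R v) + h *\<^sub>R w) v - fd g (u + a *\<^sub>R v) v
      = h * fd (\<lambda>x. fd g x v) ((u + a *\<^sub>R v) + b *\<^sub>R w) w"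
    by auto
  with 1 a show ?thesis
    by (intro that[of a b]) (auto simp: algebra_simps)
qed

text \<open>Exchanging \<open>v\<close> and \<open>w\<close> does not change the second difference,
  so the two mixed derivatives agree at two points of any small parallelogram at \<open>u\<close>;
  by continuity they cannot differ at \<open>u\<close>.\<close>

lemma second_derivative_symmetric_real:
  fixes g :: "'a::real_normed_vector \<Rightarrow> real"
  assumes "open S" "smooth_on S g" "u \<in> S"
  shows "fd (\<lambda>x. fd g x v) u w = fd (\<lambda>x. fd g x w) u v"
proof (rule ccontr)
  define F where "F x = fd (\<lambda>x. fd g x v) x w" for x
  define G where "G x = fd (\<lambda>x. fd g x w) x v" for x
  assume "\<not> ?thesis"
  then have e: "\<bar>F u - G u\<bar> / 2 > 0" by (simp add: F_def G_def)
  have "isCont F u" "isCont G u"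
    unfolding F_def G_def using assms by (auto intro!: smooth_on_isCont smooth_on_fd)
  then have "eventually (\<lambda>x. x \<in> S \<and> dist (F x) (F u) < \<bar>F u - G u\<bar> / 2 \<and> dist (G x) (G u) < \<bar>F u - G u\<bar> / 2) (nhds u)"
    using e assms unfolding isCont_def tendsto_at_iff_tendsto_nhds
    by (intro eventually_conj eventually_nhds_in_open tendstoD) auto
  then obtain d where d: "d > 0" and
    near: "\<And>x. dist x u < d \<Longrightarrow> x \<in> S \<and> dist (F x) (F u) < \<bar>F u - G u\<bar> / 2 \<and> dist (G x) (G u) < \<bar>F u - G u\<bar> / 2"
    unfolding eventually_nhds_metric by blast
  \<comment> \<open>This keeps the parallelogram within \<open>d / 2\<close> of \<open>u\<close>;
    the \<open>+ 1\<close> covers \<open>v = w = 0\<close>.\<close>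
  define h where "h = d / (2 * (norm v + norm w + 1))"
  have h: "h > 0" using d by (simp add: h_def add_nonneg_pos)
  have *: "dist (u + a *\<^sub>R v + b *\<^sub>R w) u < d" if "0 \<le> a" "a \<le> h" "0 \<le> b" "b \<le> h" for a b
  proof -
    have "dist (u + a *\<^sub>R v + b *\<^sub>R w) u \<le> norm (a *\<^sub>R v) + norm (b *\<^sub>R w)"
      using norm_triangle_ineq[of "a *\<^sub>R v" "b *\<^sub>R w"] by (simp add: dist_norm add.assoc)
    also have "\<dots> \<le> h * norm v + h * norm w"
      using that by (auto intro!: add_mono mult_right_mono)
    also have "\<dots> \<le> h * (norm v + norm w + 1)"
      using h by (simp add: algebra_simps)
    also have "\<dots> = d / 2"
    proof -
      have "d / (2 * c) * c = d / 2" if "c > 0" for c :: real using that by simp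
      from this[of "norm v + norm w + 1"] show ?thesis by (simp only: h_def) (simp add: add_nonneg_pos)
    qed
    finally show ?thesis using d by simp
  qed
  obtain a b where 1: "0 \<le> a" "a \<le> h" "0 \<le> b" "b \<le> h"
    "g (u + h *\<^sub>R v + h *\<^sub>R w) - g (u + h *\<^sub>R v) - (g (u + h *\<^sub>R w) - g u) = h * h * F (u + a *\<^sub>R v + b *\<^sub>R w)"
    using second_difference[OF assms(2) h near[OF *, THEN conjunct1]] unfolding F_def by blast
  have swap: "dist (u + a *\<^sub>R w + b *\<^sub>R v) u < d" if "0 \<le> a" "a \<le> h" "0 \<le> b" "b \<le> h" for a b
    using *[OF that(3,4,1,2)] by (simp add: add_ac)
  obtain a' b' where 2: "0 \<le> a'" "a' \<le> h" "0 \<le> b'" "b' \<le> h"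
    "g (u + h *\<^sub>R w + h *\<^sub>R v) - g (u + h *\<^sub>R w) - (g (u + h *\<^sub>R v) - g u) = h * h * G (u + a' *\<^sub>R w + b' *\<^sub>R v)"
    using second_difference[OF assms(2) h near[OF swap, THEN conjunct1]] unfolding G_def by blast
  have "h * h * F (u + a *\<^sub>R v + b *\<^sub>R w) = h * h * G (u + b' *\<^sub>R v + a' *\<^sub>R w)"
    using 1(5) 2(5) by (simp add: algebra_simps)
  then have "F (u + a *\<^sub>R v + b *\<^sub>R w) = G (u + b' *\<^sub>R v + a' *\<^sub>R w)"
    using h by simp
  then show False
    using e near[OF *[OF 1(1-4)]] near[OF *[OF 2(3,4,1,2)]] unfolding dist_real_def
    by (smt (verit) field_sum_of_halves)
qed

lemma second_derivative_symmetric: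
  fixes g :: "'a::real_normed_vector \<Rightarrow> 'b::euclidean_space"
  assumes "open S" "smooth_on S g" "u \<in> S"
  shows "fd (\<lambda>x. fd g x v) u w = fd (\<lambda>x. fd g x w) u v"
proof (rule euclidean_eqI)
  fix b :: 'b
  have inner: "fd (\<lambda>x. G x \<bullet> b) x y = fd G x y \<bullet> b" if "smooth_on S G" "x \<in> S" for G :: "'a \<Rightarrow> 'b" and x y
    by (rule fd_eq[OF bounded_linear.has_derivative[OF bounded_linear_inner_left smooth_on_has_derivative[OF that]]])
  have iter: "fd (\<lambda>x. fd g x y) u z \<bullet> b = fd (\<lambda>x. fd (\<lambda>x. g x \<bullet> b) x y) u z" for y z
  proof -
    have "fd (\<lambda>x. fd g x y) u z \<bullet> b = fd (\<lambda>x. fd g x y \<bullet> b) u z"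
      using assms by (simp add: inner smooth_on_fd)
    also have "\<dots> = fd (\<lambda>x. fd (\<lambda>x. g x \<bullet> b) x y) u z"
    proof (rule fun_cong[OF frechet_derivative_transform_within_open[OF _ assms(1,3)]])
      have "smooth_on S (\<lambda>x. fd g x y \<bullet> b)"
        using assms by (intro smooth_on_inner smooth_on_fd smooth_on_const)
      then show "(\<lambda>x. fd g x y \<bullet> b) differentiable at u"
        using assms(3) smooth_on_has_derivative differentiableI by blast
    qed (simp add: inner assms)
    finally show ?thesis .
  qed
  show "fd (\<lambda>x. fd g x v) u w \<bullet> b = fd (\<lambda>x. fd g x w) u v \<bullet> b"
    unfolding iter using assms
    by (intro second_derivative_symmetric_real[of S]) (auto intro: smooth_on_inner smooth_on_const)
qed

section \<open>Kernels of symmetric matrices of locally constant rank\<close>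

lemma symmetric_matrix_inner:
  fixes H :: "real^'n::finite^'n"
  assumes "transpose H = H"
  shows "(H *v x) \<bullet> y = x \<bullet> (H *v y)"
  by (metis assms dot_lmul_matrix inner_commute vector_transpose_matrix)

lemma subspace_matrix_kernel: "subspace {x. (H :: real^'n::finite^'m::finite) *v x = 0}"
  by (simp add: subspace_def matrix_vector_right_distrib matrix_vector_mult_scaleR)

text \<open>
  \<open>Q\<close> projects orthogonally onto \<open>ker (H p\<^sub>0)\<close>, and \<open>R p\<close> inverts \<open>H p + Q\<close>. Since \<open>ker (H p)\<close> is always
  contained in \<open>R p ` ker (H p\<^sub>0)\<close>, the dimension hypothesis forces equality, so that kernel vectors
  extend smoothly to nearby points.
\<close>

lemma local_kernel_inverse:
  fixes H :: "'p::real_normed_vector \<Rightarrow> real^'n::finite^'n"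
  assumes G: "open G" "smooth_on G H" "p0 \<in> G" and sym: "transpose (H p0) = H p0"
    and dim: "\<And>p. p \<in> G \<Longrightarrow> dim {x. H p0 *v x = 0} \<le> dim {x. H p *v x = 0}"
  obtains G' R Q where "open G'" "p0 \<in> G'" "G' \<subseteq> G" "smooth_on G' R"
    "\<forall>p\<in>G'. R p ** (H p + Q) = mat 1"
    "\<forall>p\<in>G'. \<forall>y. H p *v (R p *v (Q *v y)) = 0"
    "\<forall>p\<in>G'. {x. H p *v x = 0} = (*v) (R p) ` {x. H p0 *v x = 0}"
    "\<forall>p\<in>G'. dim {x. H p *v x = 0} = dim {x. H p0 *v x = 0}"
proof -
  define K where "K = {x. H p0 *v x = 0}"
  have K: "subspace K" unfolding K_def by (rule subspace_matrix_kernel)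
  obtain E where E: "E \<subseteq> K" "independent E" "span E = K"
    using orthonormal_basis_subspace[OF K] by metis
  have finE: "finite E" using E(2) independent_imp_finite by blast
  define Q where "Q = matrix (\<lambda>x. \<Sum>b\<in>E. (b \<bullet> x) *\<^sub>R b)"
  have Q: "Q *v x = (\<Sum>b\<in>E. (b \<bullet> x) *\<^sub>R b)" for x
    unfolding Q_def
    by (rule matrix_works, unfold linear_matrix_vector_mul_eq)
      (auto simp: linear_iff inner_right_distrib scaleR_left_distrib sum.distrib scaleR_sum_right)
  have QK: "Q *v x \<in> K" for x
    unfolding Q using E(1) K by (auto intro!: subspace_sum subspace_scale)
  \<comment> \<open>\<open>H p0 + Q\<close> is injective: by symmetry the range of
    \<open>H p0\<close> is orthogonal to \<open>K\<close>, so both summands vanish; then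
    \<open>x\<close> lies in \<open>K\<close> and is orthogonal to \<open>K\<close>.\<close>
  have "x = 0" if x: "(H p0 + Q) *v x = 0" for x
  proof -
    have "H p0 *v x = - (Q *v x)"
      using x by (simp add: matrix_vector_mult_add_rdistrib eq_neg_iff_add_eq_0)
    moreover have "(H p0 *v x) \<bullet> (Q *v x) = 0"
      using QK[of x] by (simp add: symmetric_matrix_inner[OF sym] K_def)
    ultimately have Qx: "Q *v x = 0" and xK: "x \<in> K"
      by (auto simp: K_def)
    have "(\<Sum>b\<in>E. (b \<bullet> x)\<^sup>2) = x \<bullet> (Q *v x)"
      by (simp add: Q inner_sum_right inner_commute power2_eq_square)
    then have "b \<bullet> x = 0" if "b \<in> E" for b
      using Qx that finE by (simp add: sum_nonneg_eq_0_iff)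
    then have orth: "orthogonal x y" if "y \<in> span E" for y
      using that by (intro orthogonal_to_span[of y E]) (simp_all add: orthogonal_def inner_commute)
    then show "x = 0"
      using orth[of x] xK E(3) by (simp add: orthogonal_self)
  qed
  then have det0: "det (H p0 + Q) \<noteq> 0"
    by (simp add: invertible_det_nz[symmetric] invertible_left_inverse matrix_left_invertible_ker)
  have smQ: "smooth_on G (\<lambda>p. H p + Q)"
    by (intro smooth_on_add smooth_on_const G)
  define G' where "G' = G \<inter> (\<lambda>p. det (H p + Q)) -` (- {0})"
  have G': "open G'"
    unfolding G'_def
    by (intro continuous_open_preimage smooth_on_continuous smooth_on_det smooth_on_vec_nth smQ G) auto
  have sub: "G' \<subseteq> G" "p0 \<in> G'" "\<And>p. p \<in> G' \<Longrightarrow> det (H p + Q) \<noteq> 0"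
    using det0 G by (auto simp: G'_def)
  obtain R where R: "smooth_on G' R" "\<And>p. p \<in> G' \<Longrightarrow> R p ** (H p + Q) = mat 1"
    "\<And>p. p \<in> G' \<Longrightarrow> (H p + Q) ** R p = mat 1"
    using smooth_on_matrix_inv[OF G' smooth_on_subset[OF smQ sub(1)] sub(3)] by blast
  have kernel: "{x. H p *v x = 0} = (*v) (R p) ` K" if p: "p \<in> G'" for p
  proof -
    have "{x. H p *v x = 0} \<subseteq> (*v) (R p) ` K"
    proof
      fix x assume "x \<in> {x. H p *v x = 0}"
      \<comment> \<open>On the kernel of \<open>H p\<close> the matrix \<open>H p + Q\<close> acts
        as \<open>Q\<close>, and \<open>R p\<close> undoes it.\<close>
      then have "x = R p *v (Q *v x)"
        using arg_cong[OF R(2)[OF p], of "\<lambda>A. A *v x"]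
        by (simp add: matrix_vector_mult_add_rdistrib flip: matrix_vector_mul_assoc)
      then show "x \<in> (*v) (R p) ` K" using QK by blast
    qed
    moreover have "dim ((*v) (R p) ` K) \<le> dim {x. H p *v x = 0}"
      using dim_image_le[OF matrix_vector_mul_linear, of "R p" K] dim[of p] sub(1) p
      unfolding K_def by (meson le_trans subsetD)
    ultimately show "{x. H p *v x = 0} = (*v) (R p) ` K"
      by (intro subspace_dim_equal subspace_matrix_kernel linear_subspace_image K matrix_vector_mul_linear)
  qed
  have "H p *v (R p *v (Q *v y)) = 0" if "p \<in> G'" for p y
    using kernel[OF that] QK by blast
  moreover have "dim {x. H p *v x = 0} = dim K" if p: "p \<in> G'" for p
    using kernel[OF p] dim_image_le[OF matrix_vector_mul_linear, of "R p" K] dim[of p] sub(1) p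
    unfolding K_def by (metis antisym subsetD)
  ultimately show ?thesis
    using that[OF G' sub(2,1) R(1)] R(2) kernel unfolding K_def by blast
qed

text \<open>By the dimension hypothesis \<open>v\<close> extends to a smooth field \<open>x\<close>
  with \<open>H p *v x p = 0\<close>. Differentiating this, the term that contains
  \<open>H p0\<close> is orthogonal to \<open>w\<close> by symmetry.\<close>

lemma kernel_derivative_zero:
  fixes H :: "'p::real_normed_vector \<Rightarrow> real^'n::finite^'n"
  assumes G: "open G" "smooth_on G H" "p0 \<in> G" and sym: "transpose (H p0) = H p0"
    and dim: "\<And>p. p \<in> G \<Longrightarrow> dim {x. H p0 *v x = 0} \<le> dim {x. H p *v x = 0}"
    and v: "H p0 *v v = 0" and w: "H p0 *v w = 0"
  shows "w \<bullet> (fd H p0 d *v v) = 0"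
proof -
  obtain G' R Q where G': "open G'" "p0 \<in> G'" "G' \<subseteq> G" "smooth_on G' R"
    "\<forall>p\<in>G'. R p ** (H p + Q) = mat 1"
    "\<forall>p\<in>G'. \<forall>y. H p *v (R p *v (Q *v y)) = 0"
    "\<forall>p\<in>G'. {x. H p *v x = 0} = (*v) (R p) ` {x. H p0 *v x = 0}"
    "\<forall>p\<in>G'. dim {x. H p *v x = 0} = dim {x. H p0 *v x = 0}"
    by (rule local_kernel_inverse[OF G sym dim])
  define x where "x p = R p *v (Q *v v)" for p
  have x0: "x p0 = v"
    using arg_cong[OF bspec[OF G'(5,2)], of "\<lambda>A. A *v v"] v
    by (simp add: x_def matrix_vector_mult_add_rdistrib flip: matrix_vector_mul_assoc)
  have smx: "smooth_on G' x"
    unfolding x_def by (intro smooth_on_matrix_vector smooth_on_const G')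
  have "((\<lambda>p. H p *v x p) has_derivative (\<lambda>d. H p0 *v fd x p0 d + fd H p0 d *v x p0)) (at p0)"
    by (intro bounded_bilinear.FDERIV[OF bounded_bilinear_matrix_vector]
        smooth_on_has_derivative[OF G(2,3)] smooth_on_has_derivative[OF smx G'(2)])
  moreover have "((\<lambda>p. H p *v x p) has_derivative (\<lambda>d. 0)) (at p0)"
    using G'(6) by (intro has_derivative_transform_within_open[OF has_derivative_const[of 0] G'(1,2)]) (simp add: x_def)
  ultimately have "(\<lambda>d. H p0 *v fd x p0 d + fd H p0 d *v x p0) = (\<lambda>d. 0)"
    by (rule has_derivative_unique)
  then have "H p0 *v fd x p0 d + fd H p0 d *v v = 0"
    using x0 by metis
  then have "w \<bullet> (H p0 *v fd x p0 d) + w \<bullet> (fd H p0 d *v v) = 0"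
    by (metis inner_add_right inner_zero_right)
  moreover have "w \<bullet> (H p0 *v fd x p0 d) = 0"
    using w by (simp add: symmetric_matrix_inner[OF sym, symmetric])
  ultimately show ?thesis by simp
qed

text \<open>The weight \<open>exp (- 2 * c * t)\<close> makes the squared norm of \<open>h\<close>
  nonincreasing, and it starts at zero.\<close>

lemma gronwall_zero:
  fixes h :: "real \<Rightarrow> 'a::real_inner"
  assumes h: "\<And>t. t \<in> {0..1} \<Longrightarrow> (h has_vector_derivative h' t) (at t)"
    and le: "\<And>t. t \<in> {0..1} \<Longrightarrow> norm (h' t) \<le> c * norm (h t)"
    and "h 0 = 0" "t \<in> {0..1}"
  shows "h t = 0"
proof -
  define \<phi> where "\<phi> t = exp (- 2 * c * t) * (h t \<bullet> h t)" for t
  have "\<phi> t \<le> \<phi> 0"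
  proof (rule DERIV_nonpos_imp_nonincreasing[of 0 t])
    fix s assume s: "0 \<le> s" "s \<le> t"
    then have s1: "s \<in> {0..1}" using assms(4) by auto
    have "((\<lambda>t. h t \<bullet> h t) has_real_derivative 2 * (h s \<bullet> h' s)) (at s)"
      using bounded_bilinear.has_vector_derivative[OF bounded_bilinear_inner h[OF s1] h[OF s1]]
      by (simp add: has_real_derivative_iff_has_vector_derivative inner_commute)
    then have "(\<phi> has_real_derivative
        exp (- 2 * c * s) * (2 * (h s \<bullet> h' s)) + - 2 * c * exp (- 2 * c * s) * (h s \<bullet> h s)) (at s)"
      unfolding \<phi>_def by (auto intro!: derivative_eq_intros)
    moreover have "h s \<bullet> h' s \<le> c * (h s \<bullet> h s)"
      using norm_cauchy_schwarz[of "h s" "h' s"] mult_left_mono[OF le[OF s1] norm_ge_zero[of "h s"]]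
      by (simp add: dot_square_norm power2_eq_square algebra_simps)
    then have "exp (- 2 * c * s) * (2 * (h s \<bullet> h' s)) + - 2 * c * exp (- 2 * c * s) * (h s \<bullet> h s) \<le> 0"
      using mult_left_mono[of "h s \<bullet> h' s" "c * (h s \<bullet> h s)" "2 * exp (- 2 * c * s)"]
      by (simp add: algebra_simps)
    ultimately show "\<exists>y. (\<phi> has_real_derivative y) (at s) \<and> y \<le> 0" by blast
  qed (use assms(4) in auto)
  then have "exp (- 2 * c * t) * (h t \<bullet> h t) \<le> 0"
    using assms(3) by (simp add: \<phi>_def)
  then show ?thesis
    by (metis exp_gt_zero inner_gt_zero_iff mult_pos_pos not_le)
qed

section \<open>Gradients and Hessians\<close>

lemma fd_cong:
  assumes "open S" "x \<in> S" "\<And>y. y \<in> S \<Longrightarrow> F y = G y"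
  shows "fd F x = fd G x"
proof -
  have "(F has_derivative D) (at x) \<longleftrightarrow> (G has_derivative D) (at x)" for D
    using assms by (auto elim!: has_derivative_transform_within_open)
  then show ?thesis by (simp add: frechet_derivative_def)
qed

lemma fd_eq_sum_axis:
  fixes F :: "real^'n::finite \<Rightarrow> 'b::real_normed_vector"
  assumes "smooth_on S F" "x \<in> S"
  shows "fd F x v = (\<Sum>i\<in>UNIV. v $ i *\<^sub>R fd F x (axis i 1))"
proof -
  interpret linear "fd F x" using fd_linear[OF assms] .
  have "v = (\<Sum>i\<in>UNIV. v $ i *\<^sub>R axis i 1)"
    by (simp add: vec_eq_iff axis_def if_distrib cong: if_cong)
  then have "fd F x v = fd F x (\<Sum>i\<in>UNIV. v $ i *\<^sub>R axis i 1)" by simp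
  also have "\<dots> = (\<Sum>i\<in>UNIV. v $ i *\<^sub>R fd F x (axis i 1))"
    by (simp add: sum scale)
  finally show ?thesis .
qed

text \<open>The direction may vary with the point: in coordinates the value is a finite sum of
  products of smooth maps.\<close>

lemma smooth_on_fd_apply:
  fixes F :: "real^'n::finite \<Rightarrow> 'b::real_normed_vector"
  assumes "open S" "smooth_on S F" "smooth_on S y"
  shows "smooth_on S (\<lambda>x. fd F x (y x))"
proof -
  have "smooth_on S (\<lambda>x. \<Sum>i\<in>UNIV. y x $ i *\<^sub>R fd F x (axis i 1))"
    by (intro smooth_on_sum smooth_on_scaleR smooth_on_vec_nth smooth_on_fd assms)
  moreover have "diff_on k S (\<lambda>x. fd F x (y x))"
    if "diff_on k S (\<lambda>x. \<Sum>i\<in>UNIV. y x $ i *\<^sub>R fd F x (axis i 1))" for k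
    using that by (rule diff_on_cong[OF assms(1), rotated]) (simp add: fd_eq_sum_axis[OF assms(2)])
  ultimately show ?thesis by (simp add: smooth_on_def)
qed

lemma has_derivative_along_line:
  assumes "smooth_on S F" "u + t *\<^sub>R v \<in> S"
  shows "((\<lambda>t. F (u + t *\<^sub>R v)) has_vector_derivative fd F (u + t *\<^sub>R v) v) (at t)"
proof -
  have "((\<lambda>t. u + t *\<^sub>R v) has_derivative (\<lambda>c. c *\<^sub>R v)) (at t)"
    by (auto intro!: derivative_eq_intros)
  from diff_chain_at[OF this smooth_on_has_derivative[OF assms]]
  show ?thesis
    unfolding has_vector_derivative_def o_def
    by (rule has_derivative_eq_rhs) (simp add: fun_eq_iff linear_scale[OF fd_linear[OF assms]])
qed

definition grad :: "(real^'n::finite \<Rightarrow> real) \<Rightarrow> real^'n \<Rightarrow> real^'n" where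
  "grad g u = (\<chi> i. fd g u (axis i 1))"

definition hess :: "(real^'n::finite \<Rightarrow> real) \<Rightarrow> real^'n \<Rightarrow> real^'n^'n" where
  "hess g u = matrix (fd (grad g) u)"

lemma smooth_on_grad: "open S \<Longrightarrow> smooth_on S g \<Longrightarrow> smooth_on S (grad g)"
  unfolding grad_def by (intro smooth_on_vec_lambda smooth_on_fd)

lemma smooth_on_hess: "open S \<Longrightarrow> smooth_on S g \<Longrightarrow> smooth_on S (hess g)"
  unfolding hess_def matrix_def by (intro smooth_on_vec_lambda smooth_on_vec_nth smooth_on_fd smooth_on_grad)

lemma fd_eq_grad: "smooth_on S g \<Longrightarrow> u \<in> S \<Longrightarrow> fd g u v = grad g u \<bullet> v"
  by (subst fd_eq_sum_axis) (auto simp: grad_def inner_vec_def mult.commute)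

lemma hess_mult: "open S \<Longrightarrow> smooth_on S g \<Longrightarrow> u \<in> S \<Longrightarrow> hess g u *v v = fd (grad g) u v"
  unfolding hess_def by (rule matrix_works, unfold linear_matrix_vector_mul_eq) (rule fd_linear[OF smooth_on_grad])

lemma fd_inner:
  assumes "smooth_on S F" "smooth_on S G" "x \<in> S"
  shows "fd (\<lambda>x. F x \<bullet> G x) x v = F x \<bullet> fd G x v + fd F x v \<bullet> G x"
  by (rule fd_eq[OF has_derivative_inner[OF smooth_on_has_derivative[OF assms(1,3)]
          smooth_on_has_derivative[OF assms(2,3)]]])

text \<open>Links the Hessian, a derivative of the gradient, to the iterated derivatives whose
  symmetry is known.\<close>

lemma hess_inner:
  assumes "open S" "smooth_on S g" "u \<in> S"
  shows "fd (\<lambda>x. fd g x v) u w = (hess g u *v w) \<bullet> v"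
proof -
  have "fd (\<lambda>x. fd g x v) u w = fd (\<lambda>x. grad g x \<bullet> v) u w"
    by (rule fun_cong[OF fd_cong[OF assms(1,3)]]) (simp add: fd_eq_grad[OF assms(2)])
  also have "\<dots> = (hess g u *v w) \<bullet> v"
    using assms by (subst fd_inner[of S]) (auto intro: smooth_on_grad smooth_on_const simp: hess_mult)
  finally show ?thesis .
qed

lemma hess_symmetric:
  assumes "open S" "smooth_on S g" "u \<in> S"
  shows "transpose (hess g u) = hess g u"
proof -
  have "(hess g u *v w) \<bullet> v = (hess g u *v v) \<bullet> w" for v w
    using second_derivative_symmetric[OF assms] by (simp add: hess_inner[OF assms])
  from this[of "axis j 1" "axis i 1" for i j] show ?thesis
    by (simp add: vec_eq_iff transpose_def inner_axis matrix_vector_mul_component row_def inner_axis')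
qed

section \<open>Symmetry of the third derivative\<close>

lemma third_derivative:
  assumes "open S" "smooth_on S g" "u \<in> S"
  shows "fd (hess g) u w *v v = fd (\<lambda>x. fd (grad g) x v) u w"
proof -
  have "((\<lambda>x. hess g x *v v) has_derivative (\<lambda>w. fd (hess g) u w *v v)) (at u)"
    using bounded_linear.has_derivative[OF bounded_bilinear.bounded_linear_left[OF bounded_bilinear_matrix_vector]
        smooth_on_has_derivative[OF smooth_on_hess[OF assms(1,2)] assms(3)]] .
  then have "fd (hess g) u w *v v = fd (\<lambda>x. hess g x *v v) u w"
    by (simp add: fd_eq)
  also have "\<dots> = fd (\<lambda>x. fd (grad g) x v) u w"
    by (rule fun_cong[OF fd_cong[OF assms(1,3)]]) (simp add: hess_mult[OF assms(1,2)])
  finally show ?thesis .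
qed

text \<open>Second derivatives of \<open>grad g\<close> commute. Together with
  \<open>third_derivative_transpose\<close> this gives the full symmetry of the cubic form.\<close>

lemma third_derivative_symmetric:
  assumes "open S" "smooth_on S g" "u \<in> S"
  shows "fd (hess g) u w *v v = fd (hess g) u v *v w"
  using second_derivative_symmetric[OF assms(1) smooth_on_grad[OF assms(1,2)] assms(3)]
  by (simp add: third_derivative[OF assms])

lemma third_derivative_transpose:
  assumes "open S" "smooth_on S g" "u \<in> S"
  shows "transpose (fd (hess g) u w) = fd (hess g) u w"
proof -
  have bl: "bounded_linear (transpose :: real^'a^'a \<Rightarrow> real^'a^'a)"
    by (simp add: linear_conv_bounded_linear[symmetric] linear_iff transpose_def vec_eq_iff)
  have "transpose (fd (hess g) u w) = fd (\<lambda>x. transpose (hess g x)) u w"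
    by (rule fd_eq[OF bounded_linear.has_derivative[OF bl smooth_on_has_derivative], symmetric])
      (auto intro: smooth_on_hess assms)
  also have "\<dots> = fd (hess g) u w"
    by (rule fun_cong[OF fd_cong[OF assms(1,3)]]) (simp add: hess_symmetric[OF assms(1,2)])
  finally show ?thesis .
qed

lemma fd_linear_combination:
  assumes "smooth_on S F" "smooth_on S G" "u \<in> S"
  shows "fd (\<lambda>x. s *\<^sub>R F x + t *\<^sub>R G x) u v = s *\<^sub>R fd F u v + t *\<^sub>R fd G u v"
  by (rule fd_eq[OF has_derivative_add[OF has_derivative_scaleR_right[OF smooth_on_has_derivative[OF assms(1,3)]]
          has_derivative_scaleR_right[OF smooth_on_has_derivative[OF assms(2,3)]]]])

lemma grad_linear_combination:
  assumes "smooth_on S F" "smooth_on S G" "u \<in> S"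
  shows "grad (\<lambda>x. s * F x + t * G x) u = s *\<^sub>R grad F u + t *\<^sub>R grad G u"
  using fd_linear_combination[OF assms] by (simp add: grad_def vec_eq_iff)

lemma hess_linear_combination:
  assumes "open S" "smooth_on S F" "smooth_on S G" "u \<in> S"
  shows "hess (\<lambda>x. s * F x + t * G x) u = s *\<^sub>R hess F u + t *\<^sub>R hess G u"
proof -
  have "fd (grad (\<lambda>x. s * F x + t * G x)) u = fd (\<lambda>x. s *\<^sub>R grad F x + t *\<^sub>R grad G x) u"
    by (rule fd_cong[OF assms(1,4)]) (rule grad_linear_combination[OF assms(2,3)])
  moreover have "fd (\<lambda>x. s *\<^sub>R grad F x + t *\<^sub>R grad G x) u v = s *\<^sub>R fd (grad F) u v + t *\<^sub>R fd (grad G) u v" for v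
    using assms by (intro fd_linear_combination smooth_on_grad)
  ultimately show ?thesis
    by (simp add: hess_def matrix_def vec_eq_iff)
qed

section \<open>Leaves of the kernel distribution\<close>

text \<open>Along the segment the vector \<open>hess C *v w\<close> solves a linear differential
  equation with zero initial value: \<open>decomp\<close> splits \<open>w\<close> into a kernel
  vector, which the third derivative ignores, and a part linear in \<open>hess C *v w\<close>. So
  kernels can only grow, and their dimension is fixed.\<close>

lemma kernel_constant_along_line:
  fixes C :: "real^'n::finite \<Rightarrow> real"
  assumes G: "open G" "smooth_on G C" "smooth_on G R"
    and inv: "\<And>p. p \<in> G \<Longrightarrow> R p ** (hess C p + Q) = mat 1"
    and ker: "\<And>p y. p \<in> G \<Longrightarrow> hess C p *v (R p *v (Q *v y)) = 0"
    and dim: "\<And>p. p \<in> G \<Longrightarrow> dim {x. hess C p *v x = 0} = k"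
    and seg: "\<And>t. t \<in> {0..1} \<Longrightarrow> u + t *\<^sub>R v \<in> G"
    and v: "hess C u *v v = 0"
  shows "{x. hess C (u + v) *v x = 0} = {x. hess C u *v x = 0}"
proof -
  let ?T = "\<lambda>p d. fd (hess C) p d"
  note smH = smooth_on_hess[OF G(1,2)]
  \<comment> \<open>Constant kernel dimension makes \<open>kernel_derivative_zero\<close> available
    at every \<open>p\<close>; symmetry moves the free direction \<open>d\<close> outside, so the
    whole vector vanishes and not only its pairing with kernel vectors.\<close>
  have T0: "?T p a *v b = 0" if p: "p \<in> G" and a: "hess C p *v a = 0" and b: "hess C p *v b = 0" for p a b
  proof -
    have "b \<bullet> (?T p d *v a) = 0" for d
      using kernel_derivative_zero[OF G(1) smH p hess_symmetric[OF G(1,2) p] _ a b] dim p by simp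
    then have "(?T p a *v b) \<bullet> d = 0" for d
      unfolding symmetric_matrix_inner[OF third_derivative_transpose[OF G(1,2) p]]
        third_derivative_symmetric[OF G(1,2) p, where w = a and v = d] .
    then show ?thesis using inner_eq_zero_iff by blast
  qed
  have decomp: "w = R p *v (hess C p *v w) + R p *v (Q *v w)" if "p \<in> G" for p w
    using arg_cong[OF inv[OF that], of "\<lambda>A. A *v w"]
    by (simp add: matrix_vector_mult_add_rdistrib matrix_vector_right_distrib flip: matrix_vector_mul_assoc)
  \<comment> \<open>By \<open>eq\<close> the derivative is linear in \<open>hess C *v w\<close>,
    with coefficients bounded by compactness of the segment. The field \<open>y\<close> is left open
    because it differs in the two uses below.\<close>
  have line: "hess C (u + t *\<^sub>R v) *v w = 0"
    if w: "hess C u *v w = 0" and smy: "smooth_on G y" and t: "t \<in> {0..1}"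
      and eq: "\<And>t. t \<in> {0..1} \<Longrightarrow> ?T (u + t *\<^sub>R v) v *v w
        = ?T (u + t *\<^sub>R v) (y (u + t *\<^sub>R v)) *v (R (u + t *\<^sub>R v) *v (hess C (u + t *\<^sub>R v) *v w))"
    for w y t
  proof -
    interpret mv: bounded_bilinear "(*v) :: real^'n^'n \<Rightarrow> real^'n \<Rightarrow> real^'n"
      by (rule bounded_bilinear_matrix_vector)
    obtain K where K: "K > 0" "\<And>(A :: real^'n^'n) x. norm (A *v x) \<le> norm A * norm x * K"
      using mv.pos_bounded by auto
    have cont: "continuous_on {0..1} (\<lambda>t. F (u + t *\<^sub>R v))" if "smooth_on G F" for F :: "real^'n \<Rightarrow> real^'n^'n"
      by (rule continuous_on_compose2[OF smooth_on_continuous[OF that]])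
        (use seg in \<open>auto intro!: continuous_intros\<close>)
    have bdd: "\<exists>c. \<forall>t\<in>{0..1}. norm (F (u + t *\<^sub>R v)) \<le> c" if "smooth_on G F" for F :: "real^'n \<Rightarrow> real^'n^'n"
      using compact_imp_bounded[OF compact_continuous_image[OF cont[OF that] compact_Icc]]
      by (auto simp: bounded_iff)
    obtain c where c: "\<And>t. t \<in> {0..1} \<Longrightarrow> norm (?T (u + t *\<^sub>R v) (y (u + t *\<^sub>R v))) \<le> c"
      using bdd[OF smooth_on_fd_apply[OF G(1) smH smy]] by blast
    obtain d where d: "\<And>t. t \<in> {0..1} \<Longrightarrow> norm (R (u + t *\<^sub>R v)) \<le> d"
      using bdd[OF G(3)] by blast
    show ?thesis
    \<comment> \<open>\<open>c\<close> bounds the third derivative, \<open>d\<close> bounds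
      \<open>R\<close>, and each of the two matrix products costs a factor \<open>K\<close>.\<close>
    proof (rule gronwall_zero[where h = "\<lambda>t. hess C (u + t *\<^sub>R v) *v w" and h' = "\<lambda>t. ?T (u + t *\<^sub>R v) v *v w"
          and c = "c * d * K * K"])
      fix s :: real assume s: "s \<in> {0..1}"
      show "((\<lambda>t. hess C (u + t *\<^sub>R v) *v w) has_vector_derivative ?T (u + s *\<^sub>R v) v *v w) (at s)"
        by (rule bounded_linear.has_vector_derivative[OF mv.bounded_linear_left has_derivative_along_line[OF smH seg[OF s]]])
      let ?h = "hess C (u + s *\<^sub>R v) *v w"
      have "norm (?T (u + s *\<^sub>R v) v *v w) \<le> norm (?T (u + s *\<^sub>R v) (y (u + s *\<^sub>R v))) * norm (R (u + s *\<^sub>R v) *v ?h) * K"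
        unfolding eq[OF s] by (rule K)
      also have "\<dots> \<le> c * (d * norm ?h * K) * K"
        using K(1) by (intro mult_right_mono mult_mono c[OF s] order_trans[OF K(2)] d[OF s] order_trans[OF norm_ge_zero c[OF s]]) auto
      finally show "norm (?T (u + s *\<^sub>R v) v *v w) \<le> c * d * K * K * norm ?h"
        by (simp add: mult_ac)
    qed (use w t in auto)
  qed
  \<comment> \<open>That \<open>v\<close> stays in the kernel comes first. With kernel part
    \<open>a\<close> and remainder \<open>b\<close> of \<open>v\<close>, symmetry and
    \<open>T0\<close> turn \<open>?T p v *v v\<close> into \<open>?T p (a + v) *v b\<close>; this
    dictates \<open>y\<close>.\<close>
  have kerv: "hess C (u + t *\<^sub>R v) *v v = 0" if t: "t \<in> {0..1}" for t
  proof (rule line[OF v _ t, where y = "\<lambda>p. R p *v (Q *v v) + v"])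
    show "smooth_on G (\<lambda>p. R p *v (Q *v v) + v)"
      by (intro smooth_on_add smooth_on_matrix_vector smooth_on_const G)
    fix t :: real assume t: "t \<in> {0..1}"
    define p where "p = u + t *\<^sub>R v"
    have p: "p \<in> G" using seg[OF t] by (simp add: p_def)
    define a b where "a = R p *v (Q *v v)" and "b = R p *v (hess C p *v v)"
    have vab: "v = b + a" using decomp[OF p] by (simp add: a_def b_def)
    have a0: "hess C p *v a = 0" using ker[OF p] by (simp add: a_def)
    have lin: "linear (?T p)" by (rule fd_linear[OF smH p])
    have "?T p v *v v = ?T p v *v a + ?T p v *v b"
      by (subst (2) vab) (simp add: matrix_vector_right_distrib add.commute)
    also have "?T p v *v a = ?T p a *v v"
      by (rule third_derivative_symmetric[OF G(1,2) p])
    also have "\<dots> = ?T p a *v b"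
      by (subst vab) (simp add: matrix_vector_right_distrib T0[OF p a0 a0])
    finally have "?T p v *v v = ?T p (a + v) *v b"
      by (simp add: linear_add[OF lin] matrix_vector_mult_add_rdistrib)
    then show "?T (u + t *\<^sub>R v) v *v v = ?T (u + t *\<^sub>R v) (R (u + t *\<^sub>R v) *v (Q *v v) + v) *v (R (u + t *\<^sub>R v) *v (hess C (u + t *\<^sub>R v) *v v))"
      by (simp add: a_def b_def p_def)
  qed
  \<comment> \<open>Now \<open>v\<close> is a kernel vector along the segment, so \<open>T0\<close>
    removes the kernel part of an arbitrary \<open>w\<close>, and the constant field
    \<open>v\<close> suffices.\<close>
  have "hess C (u + 1 *\<^sub>R v) *v w = 0" if w: "hess C u *v w = 0" for w
  proof (rule line[OF w smooth_on_const[of _ v]])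
    fix t :: real assume t: "t \<in> {0..1}"
    define p where "p = u + t *\<^sub>R v"
    have p: "p \<in> G" using seg[OF t] by (simp add: p_def)
    have "?T p v *v w = ?T p v *v (R p *v (hess C p *v w)) + ?T p v *v (R p *v (Q *v w))"
      by (subst decomp[OF p, of w]) (simp add: matrix_vector_right_distrib)
    also have "?T p v *v (R p *v (Q *v w)) = 0"
      using kerv[OF t] by (intro T0[OF p] ker[OF p]) (simp add: p_def)
    finally show "?T (u + t *\<^sub>R v) v *v w = ?T (u + t *\<^sub>R v) v *v (R (u + t *\<^sub>R v) *v (hess C (u + t *\<^sub>R v) *v w))"
      by (simp add: p_def)
  qed simp
  then have "{x. hess C u *v x = 0} \<subseteq> {x. hess C (u + v) *v x = 0}" by auto
  moreover have "u \<in> G" "u + v \<in> G" using seg[of 0] seg[of 1] by auto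
  ultimately show ?thesis
    using dim by (metis subspace_dim_equal subspace_matrix_kernel order_refl)
qed

section \<open>Tangent spaces and the dual hypersurface\<close>

text \<open>Assembles the partial differential equations into \<open>dA = dB o df\<close>, the form
  that is differentiated and integrated later.\<close>

lemma conservation_law_fd:
  assumes "smooth_on U f" "smooth_on U B" "smooth_on U A" "conservation_law U f B A" "u \<in> U"
  shows "fd A u v = grad B u \<bullet> fd f u v"
proof -
  have comp: "fd (\<lambda>x. f x $ k) u w = fd f u w $ k" for k w
    by (rule fd_eq[OF bounded_linear.has_derivative[OF bounded_linear_vec_nth
            smooth_on_has_derivative[OF assms(1,5)]]])
  have "fd A u (axis i 1) = grad B u \<bullet> fd f u (axis i 1)" for i
    using assms(4,5) by (simp add: conservation_law_def partial_def comp inner_vec_def grad_def)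
  then show ?thesis
    by (simp add: fd_eq_sum_axis[OF assms(1,5), of v] fd_eq_sum_axis[OF assms(3,5), of v] inner_sum_right)
qed

lemma has_derivative_comp_fst:
  "smooth_on U F \<Longrightarrow> u \<in> U \<Longrightarrow> ((\<lambda>p. F (fst p)) has_derivative (\<lambda>h. fd F u (fst h))) (at (u, y))"
  using has_derivative_compose[OF has_derivative_fst[OF has_derivative_ident], where x = "(u, y)" and g = F]
    smooth_on_has_derivative[of U F u] by simp

section \<open>The ruled hypersurface of two conservation laws and its tangent spaces\<close>

locale two_conservation_laws =
  fixes U :: "(real^'n::finite) set" and f :: "real^'n \<Rightarrow> real^'n" and B A N M :: "real^'n \<Rightarrow> real"
  assumes open_U: "open U"
    and smooth: "smooth_on U f" "smooth_on U B" "smooth_on U A" "smooth_on U N" "smooth_on U M"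
    and laws: "conservation_law U f B A" "conservation_law U f N M"
begin

abbreviation Y :: "'n sweep" where
  "Y \<equiv> ruled_hypersurface f B A N M"

text \<open>
  The conservation laws say exactly that \<open>lift u\<close> parametrizes the tangent space along the generator
  of \<open>u\<close>, where \<open>w\<close> stands for \<open>s du + t df\<close>.
\<close>

definition lift :: "real^'n \<Rightarrow> (real^'n) \<times> real \<times> real \<Rightarrow> 'n hcoords" where
  "lift u = (\<lambda>(w, s, t). (s, s *\<^sub>R u + t *\<^sub>R f u + w, s * B u + t * A u + grad B u \<bullet> w,
     s * N u + t * M u + grad N u \<bullet> w, t))"

text \<open>The first entry is the Legendre transform of \<open>g\<close>. With
  \<open>(a, b)\<close> selecting the law, the first and last entries make the hyperplane contain
  the generator, and the vector entry makes it contain the other tangent directions.\<close>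

definition conormal :: "(real^'n \<Rightarrow> real) \<Rightarrow> (real^'n \<Rightarrow> real) \<Rightarrow> real \<Rightarrow> real \<Rightarrow> real^'n \<Rightarrow> 'n hcoords" where
  "conormal g h a b u = (u \<bullet> grad g u - g u, - grad g u, a, b, f u \<bullet> grad g u - h u)"

abbreviation X :: "real^'n \<Rightarrow> 'n hcoords" where "X \<equiv> conormal B A 1 0"
abbreviation W :: "real^'n \<Rightarrow> 'n hcoords" where "W \<equiv> conormal N M 0 1"

text \<open>The velocity of a conormal whose gradient moves with velocity \<open>g\<close>, while
  its entries \<open>a\<close>, \<open>b\<close> stay fixed.\<close>

definition colift :: "real^'n \<Rightarrow> real^'n \<Rightarrow> 'n hcoords" where
  "colift u g = (u \<bullet> g, - g, 0, 0, f u \<bullet> g)"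

lemma linear_lift: "linear (lift u)"
  by (auto simp: linear_iff lift_def algebra_simps)

lemma inj_lift: "inj (lift u)"
  by (auto simp: inj_def lift_def)

lemma Y_eq_lift: "Y (u, s, t) = lift u (0, s, t)"
  by (simp add: ruled_hypersurface_def lift_def mult.commute)

lemma fd_law: "u \<in> U \<Longrightarrow> fd A u v = grad B u \<bullet> fd f u v" "u \<in> U \<Longrightarrow> fd M u v = grad N u \<bullet> fd f u v"
  using conservation_law_fd smooth laws by blast+

text \<open>The laws replace \<open>dA\<close> and \<open>dM\<close> by the gradients of
  \<open>B\<close> and \<open>N\<close> applied to \<open>df\<close>, so the motion of
  \<open>u\<close> enters only through \<open>s du + t df\<close>.\<close>

lemma has_derivative_Y:
  assumes u: "u \<in> U"
  shows "(Y has_derivative (\<lambda>(v, a, b). lift u (s *\<^sub>R v + t *\<^sub>R fd f u v, a, b))) (at (u, s, t))"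
proof -
  have Y: "Y = (\<lambda>p. (fst (snd p), fst (snd p) *\<^sub>R fst p + snd (snd p) *\<^sub>R f (fst p),
      B (fst p) * fst (snd p) + A (fst p) * snd (snd p), N (fst p) * fst (snd p) + M (fst p) * snd (snd p), snd (snd p)))"
    by (auto simp: ruled_hypersurface_def)
  note [derivative_intros] = has_derivative_comp_fst[OF smooth(1) u] has_derivative_comp_fst[OF smooth(2) u]
    has_derivative_comp_fst[OF smooth(3) u] has_derivative_comp_fst[OF smooth(4) u] has_derivative_comp_fst[OF smooth(5) u]
  show ?thesis
    unfolding Y
    by (rule derivative_eq_intros refl)+
      (auto simp: lift_def fun_eq_iff fd_law[OF u] fd_eq_grad[OF smooth(2) u] fd_eq_grad[OF smooth(4) u] algebra_simps)
qed

lemma fd_Y: "u \<in> U \<Longrightarrow> fd Y (u, s, t) = (\<lambda>(v, a, b). lift u (s *\<^sub>R v + t *\<^sub>R fd f u v, a, b))"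
  using frechet_derivative_at[OF has_derivative_Y] by simp

lemma linear_speed: "u \<in> U \<Longrightarrow> linear (\<lambda>v. s *\<^sub>R v + t *\<^sub>R fd f u v)"
  by (intro linear_compose_add linear_compose_scale_right linear_ident fd_linear[OF smooth(1)])

lemma smooth_point_Y:
  assumes u: "u \<in> U"
  shows "smooth_point Y (u, s, t) \<longleftrightarrow> inj (\<lambda>v. s *\<^sub>R v + t *\<^sub>R fd f u v)"
proof -
  have "lift u (v, a, b) = lift u (v', a', b') \<longleftrightarrow> (v, a, b) = (v', a', b')" for v a b v' a' b'
    using inj_lift by (simp add: inj_eq)
  then show ?thesis
    unfolding smooth_point_def fd_Y[OF u] by (auto simp: inj_def)
qed

text \<open>At a smooth point the square map \<open>s du + t df\<close> is onto, so \<open>w\<close>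
  is unrestricted and \<open>(s, t)\<close> drops out.\<close>

lemma tangent_space_Y:
  assumes u: "u \<in> U" and p: "smooth_point Y (u, s, t)"
  shows "tangent_space Y (u, s, t) = range (lift u)"
proof -
  have "surj (\<lambda>v. s *\<^sub>R v + t *\<^sub>R fd f u v)"
    using linear_injective_imp_surjective[OF linear_speed[OF u]] p smooth_point_Y[OF u] by blast
  then have "\<exists>v. w = s *\<^sub>R v + t *\<^sub>R fd f u v" for w by (meson surjD)
  then show ?thesis
    unfolding tangent_space_def fd_Y[OF u]
    by (auto simp: image_iff) metis
qed

text \<open>Every generator has a smooth point, so the condition in \<open>tangent_pencil\<close> is
  never vacuous.\<close>

lemma smooth_point_Y_1_0: "u \<in> U \<Longrightarrow> smooth_point Y (u, 1, 0)"
  by (simp add: smooth_point_Y inj_def)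

lemma inner_lift_conormal: "conormal g h a b u \<bullet> lift u (w, s, t)
    = a * (s * B u + t * A u + grad B u \<bullet> w) + b * (s * N u + t * M u + grad N u \<bullet> w)
      - s * g u - t * h u - grad g u \<bullet> w"
  by (simp add: conormal_def lift_def inner_add_left inner_add_right inner_diff_left inner_commute algebra_simps)

text \<open>In \<open>lift u\<close> the two law entries are functions of the others; pairing with
  \<open>X u\<close> and \<open>W u\<close> measures the error in them, and the preimage is read off
  the remaining entries.\<close>

lemma range_lift_eq: "range (lift u) = {y. X u \<bullet> y = 0 \<and> W u \<bullet> y = 0}"
proof (intro equalityI subsetI)
  fix y assume "y \<in> {y. X u \<bullet> y = 0 \<and> W u \<bullet> y = 0}"
  moreover obtain y0 y1 b c y3 where y: "y = (y0, y1, b, c, y3)" by (metis prod.collapse)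
  ultimately have "y = lift u (y1 - y0 *\<^sub>R u - y3 *\<^sub>R f u, y0, y3)"
    by (simp add: lift_def conormal_def inner_diff_right inner_commute algebra_simps)
  then show "y \<in> range (lift u)" by blast
qed (auto simp: inner_lift_conormal)

text \<open>Testing \<open>z\<close> on \<open>(w, 0, 0)\<close> fixes its vector entry, and testing
  on the generator fixes its first and last entries; \<open>b\<close> and \<open>c\<close> become
  the coefficients.\<close>

lemma span_conormal_eq: "span {X u, W u} = {z. \<forall>y \<in> range (lift u). z \<bullet> y = 0}"
proof (intro equalityI subsetI)
  fix z assume "z \<in> span {X u, W u}"
  then show "z \<in> {z. \<forall>y \<in> range (lift u). z \<bullet> y = 0}"
    by (auto simp: span_insert span_singleton range_lift_eq inner_diff_left algebra_simps)
next
  fix z assume z: "z \<in> {z. \<forall>y \<in> range (lift u). z \<bullet> y = 0}"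
  obtain z0 z1 b c z3 where zz: "z = (z0, z1, b, c, z3)" by (metis prod.collapse)
  have "(z1 + b *\<^sub>R grad B u + c *\<^sub>R grad N u) \<bullet> w = 0" for w
  proof -
    have "z \<bullet> lift u (w, 0, 0) = 0" using z by auto
    then show ?thesis by (simp add: zz lift_def inner_add_left)
  qed
  then have z1: "z1 = - (b *\<^sub>R grad B u) - c *\<^sub>R grad N u"
    using inner_eq_zero_iff[of "z1 + b *\<^sub>R grad B u + c *\<^sub>R grad N u"]
    by (simp add: algebra_simps eq_neg_iff_add_eq_0)
  have "z \<bullet> lift u (0, 1, 0) = 0" "z \<bullet> lift u (0, 0, 1) = 0"
    using z by auto
  then have "z = b *\<^sub>R X u + c *\<^sub>R W u"
    by (simp add: zz z1 lift_def conormal_def inner_diff_left inner_commute algebra_simps)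
  then show "z \<in> span {X u, W u}"
    by (simp add: span_add span_base span_scale)
qed

lemma tangent_hyperplane_Y:
  assumes "u \<in> U" "smooth_point Y (u, s, t)"
  shows "tangent_hyperplane_at Y (u, s, t) z \<longleftrightarrow> z \<in> span {X u, W u} - {0}"
  unfolding tangent_hyperplane_at_def tangent_space_Y[OF assms] span_conormal_eq by auto

section \<open>The dual hypersurface and its generators\<close>

lemma smooth_on_conormal:
  assumes "smooth_on U g" "smooth_on U h"
  shows "smooth_on U (conormal g h a b)"
  unfolding conormal_def
  by (intro smooth_on_Pair smooth_on_diff smooth_on_inner smooth_on_minus smooth_on_const smooth_on_ident
      smooth_on_grad assms smooth open_U)

lemma dual_generators_Y: "dual_generators U Y X W"
  unfolding dual_generators_def
proof (intro conjI ballI)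
  show "smooth_on U X" "smooth_on U W"
    by (intro smooth_on_conormal smooth)+
  fix u assume u: "u \<in> U"
  have "independent {X u, W u}"
    by (rule independent_insertI) (auto simp: span_singleton conormal_def zero_prod_def)
  moreover have "X u \<noteq> W u" by (simp add: conormal_def)
  ultimately show "dim (span {X u, W u}) = 2"
    by (simp add: dim_eq_card_independent)
  show "tangent_pencil U Y u = span {X u, W u} - {0}"
    unfolding tangent_pencil_def smooth_points_def
    using u smooth_point_Y_1_0[OF u] by (auto simp: tangent_hyperplane_Y)
next
  show "dual_hypersurface U Y = (\<Union>u\<in>U. span {X u, W u} - {0})"
    unfolding dual_hypersurface_def smooth_points_def
    using smooth_point_Y_1_0 tangent_hyperplane_Y by fastforce
qed

text \<open>A nonzero vector orthogonal to \<open>H\<close> pairs to zero with all conormals, so it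
  would be a common point of the tangent spaces.\<close>

lemma dual_hypersurface_nondegenerate:
  assumes "\<not> tangent_spaces_concurrent U Y" "subspace H" "dual_hypersurface U Y \<subseteq> H"
  shows "H = UNIV"
proof (rule ccontr)
  assume "H \<noteq> UNIV"
  then have "span H \<subset> UNIV" using assms(2) by (simp add: span_eq_iff[THEN iffD2] top.not_eq_extremum)
  then obtain y where y: "y \<noteq> 0" "\<And>z. z \<in> span H \<Longrightarrow> orthogonal y z"
    using orthogonal_to_subspace_exists_gen[of H UNIV] span_UNIV by metis
  have "X u \<bullet> y = 0 \<and> W u \<bullet> y = 0" if "u \<in> U" for u
  proof -
    have "X u \<noteq> 0" "W u \<noteq> 0" by (auto simp: conormal_def zero_prod_def)
    then have "X u \<in> dual_hypersurface U Y" "W u \<in> dual_hypersurface U Y"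
      using dual_generators_Y that by (auto simp: dual_generators_def intro: span_base)
    then have "X u \<in> H" "W u \<in> H"
      using assms(3) by auto
    then show ?thesis
      using y(2)[OF span_base] by (metis orthogonal_def inner_commute)
  qed
  then have "y \<in> tangent_space Y p" if "p \<in> smooth_points U Y" for p
    using that by (cases p) (auto simp: smooth_points_def tangent_space_Y range_lift_eq)
  then show False
    using assms(1) y(1) unfolding tangent_spaces_concurrent_def by blast
qed

text \<open>The gradient terms cancel, against \<open>dg\<close> in the first entry and, by the law,
  against \<open>dh\<close> in the last; only the Hessian remains.\<close>

lemma has_derivative_conormal:
  assumes u: "u \<in> U" and g: "smooth_on U g" and h: "smooth_on U h" "conservation_law U f g h"
  shows "(conormal g h a b has_derivative (\<lambda>v. colift u (hess g u *v v))) (at u)"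
proof -
  note [derivative_intros] = smooth_on_has_derivative[OF smooth(1) u] smooth_on_has_derivative[OF g u]
    smooth_on_has_derivative[OF h(1) u] smooth_on_has_derivative[OF smooth_on_grad[OF open_U g] u]
  show ?thesis
    unfolding conormal_def
    by (rule derivative_eq_intros refl)+
      (auto simp: colift_def fun_eq_iff hess_mult[OF open_U g u] fd_eq_grad[OF g u] inner_commute
        conservation_law_fd[OF smooth(1) g h u])
qed

section \<open>Derivative and smooth points of the dual sweep\<close>

abbreviation pencil :: "(real^'n) \<times> real \<times> real \<Rightarrow> real^'n^'n" where
  "pencil p \<equiv> fst (snd p) *\<^sub>R hess B (fst p) + snd (snd p) *\<^sub>R hess N (fst p)"

lemma linear_colift: "linear (colift u)"
  by (auto simp: linear_iff colift_def inner_add_right algebra_simps)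

lemma fd_dual_sweep:
  assumes u: "u \<in> U"
  shows "fd (line_sweep X W) (u, s, t)
    = (\<lambda>(v, a, b). a *\<^sub>R X u + b *\<^sub>R W u + colift u (pencil (u, s, t) *v v))"
proof -
  have Y: "line_sweep X W = (\<lambda>p. fst (snd p) *\<^sub>R X (fst p) + snd (snd p) *\<^sub>R W (fst p))"
    by (auto simp: line_sweep_def)
  note [derivative_intros] =
    has_derivative_comp_fst[OF smooth_on_conormal[OF smooth(2,3)] u]
    has_derivative_comp_fst[OF smooth_on_conormal[OF smooth(4,5)] u]
  have "fd X u v = colift u (hess B u *v v)" "fd W u v = colift u (hess N u *v v)" for v
    using has_derivative_conormal[OF u] smooth laws by (auto intro!: fd_eq)
  then have "(line_sweep X W has_derivative
      (\<lambda>(v, a, b). a *\<^sub>R X u + b *\<^sub>R W u + colift u (pencil (u, s, t) *v v))) (at (u, s, t))"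
    unfolding Y
    by - ((rule derivative_eq_intros refl)+,
      auto simp: fun_eq_iff linear_add[OF linear_colift] linear_scale[OF linear_colift]
        matrix_vector_mult_add_rdistrib scaleR_matrix_vector_assoc[symmetric])
  then show ?thesis using frechet_derivative_at by metis
qed

text \<open>The third and fourth entries are \<open>a\<close> and \<open>b\<close>; the vector entry
  then determines \<open>g\<close>.\<close>

lemma dual_sweep_injective:
  "a *\<^sub>R X u + b *\<^sub>R W u + colift u g = a' *\<^sub>R X u + b' *\<^sub>R W u + colift u g' \<longleftrightarrow> a = a' \<and> b = b' \<and> g = g'"
  by (auto simp: conormal_def colift_def)

lemma smooth_point_dual:
  assumes u: "u \<in> U"
  shows "smooth_point (line_sweep X W) (u, s, t) \<longleftrightarrow> inj ((*v) (pencil (u, s, t)))"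
  unfolding smooth_point_def fd_dual_sweep[OF u] by (auto simp: inj_def dual_sweep_injective)

text \<open>At a smooth point the Hessian is onto, so \<open>(s, t)\<close> disappears from the
  range of the derivative.\<close>

lemma stable_dual: "stable_along_generators U (line_sweep X W)"
proof -
  have "tangent_space (line_sweep X W) (u, s, t) = {a *\<^sub>R X u + b *\<^sub>R W u + colift u g | a b g. True}"
    if u: "u \<in> U" and p: "smooth_point (line_sweep X W) (u, s, t)" for u s t
  proof -
    have "surj ((*v) (pencil (u, s, t)))"
      using p unfolding smooth_point_dual[OF u]
      by (intro linear_injective_imp_surjective matrix_vector_mul_linear) auto
    then have "\<exists>v. g = pencil (u, s, t) *v v" for g by (meson surjD)
    then show ?thesis
      unfolding tangent_space_def fd_dual_sweep[OF u] by (auto simp: image_iff) metis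
  qed
  then show ?thesis
    unfolding stable_along_generators_def smooth_points_def by simp
qed

end

section \<open>A degenerate dual hypersurface\<close>

text \<open>The map \<open>l\<close> allows only a part of the derivative to be known: its image
  under the pencil matrix, its pairing with a kernel vector, or all of it.\<close>

lemma increment_on_segment:
  fixes F :: "real^'n::finite \<Rightarrow> 'b::real_normed_vector"
  assumes "smooth_on S F" "\<And>t. t \<in> {0..1} \<Longrightarrow> u + t *\<^sub>R v \<in> S"
    and "bounded_linear l" "\<And>t. t \<in> {0..1} \<Longrightarrow> l (fd F (u + t *\<^sub>R v) v) = l c"
  shows "l (F (u + v) - F u) = l c"
proof -
  interpret l: bounded_linear l by fact
  have "((\<lambda>t. l (F (u + t *\<^sub>R v)) - t *\<^sub>R l c) has_vector_derivative 0) (at t within {0..1})"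
    if t: "t \<in> {0..1}" for t
  proof -
    have "((\<lambda>t. l (F (u + t *\<^sub>R v)) - t *\<^sub>R l c) has_vector_derivative l (fd F (u + t *\<^sub>R v) v) - l c) (at t)"
      using bounded_linear.has_vector_derivative[OF assms(3) has_derivative_along_line[OF assms(1) assms(2)[OF t]]]
      by (auto intro!: derivative_eq_intros)
    then show ?thesis
      using assms(4)[OF t] by (auto intro: has_vector_derivative_at_within)
  qed
  then obtain d where "\<And>t. t \<in> {0..1} \<Longrightarrow> l (F (u + t *\<^sub>R v)) - t *\<^sub>R l c = d"
    by (rule has_vector_derivative_zero_constant[of "{0..1::real}", rotated]) auto
  from this[of 0] this[of 1] show ?thesis by (simp add: l.diff algebra_simps)
qed

context two_conservation_laws
begin

text \<open>In the derivative of \<open>dh = grad g . df\<close> the second derivatives of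
  \<open>h\<close> and \<open>f\<close> are symmetric, hence so is the remaining term.\<close>

lemma speed_symmetric:
  assumes g: "smooth_on U g" and h: "smooth_on U h" "conservation_law U f g h" and u: "u \<in> U"
  shows "(hess g u *v w) \<bullet> fd f u v = (hess g u *v v) \<bullet> fd f u w"
proof -
  have "fd (\<lambda>x. fd h x y) u z = grad g u \<bullet> fd (\<lambda>x. fd f x y) u z + (hess g u *v z) \<bullet> fd f u y" for y z
  proof -
    have "fd (\<lambda>x. fd h x y) u z = fd (\<lambda>x. grad g x \<bullet> fd f x y) u z"
      by (rule fun_cong[OF fd_cong[OF open_U u]]) (rule conservation_law_fd[OF smooth(1) g h])
    also have "\<dots> = grad g u \<bullet> fd (\<lambda>x. fd f x y) u z + (hess g u *v z) \<bullet> fd f u y"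
      by (subst fd_inner[OF smooth_on_grad[OF open_U g] smooth_on_fd[OF smooth(1)] u])
        (simp add: hess_mult[OF open_U g u])
    finally show ?thesis .
  qed
  from this[of v w] this[of w v] show ?thesis
    using second_derivative_symmetric[OF open_U h(1) u, of v w]
      second_derivative_symmetric[OF open_U smooth(1) u, of v w] by simp
qed

lemma smooth_on_pencil:
  assumes "open G" "G \<subseteq> U \<times> UNIV"
  shows "smooth_on G pencil"
proof -
  have fst: "smooth_on G (\<lambda>p. F (fst p))" if "smooth_on U F" for F :: "real^'n \<Rightarrow> real^'n^'n"
    using assms(2) by (intro smooth_on_compose_linear[OF assms(1) bounded_linear_fst that]) auto
  show ?thesis
    by (intro smooth_on_add smooth_on_scaleR fst smooth_on_hess open_U smooth assms(1)
        smooth_on_linear[OF _ bounded_linear_fst] smooth_on_linear[OF _ bounded_linear_snd] smooth_on_ident)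
qed

text \<open>With \<open>J\<close> the matrix of \<open>s du + t df\<close>, smooth points are those
  with nonzero determinant.\<close>

lemma open_smooth_points_Y:
  assumes "open V" "V \<subseteq> U"
  shows "open (smooth_points V Y)"
proof -
  define J where "J p = fst (snd p) *\<^sub>R (mat 1 :: real^'n^'n) + snd (snd p) *\<^sub>R matrix (fd f (fst p))" for p
  have oV: "open (V \<times> (UNIV :: (real \<times> real) set))"
    by (intro open_Times assms) auto
  have mat: "smooth_on U (\<lambda>u. matrix (fd f u))"
    unfolding matrix_def by (intro smooth_on_vec_lambda smooth_on_vec_nth smooth_on_fd smooth open_U)
  have fst: "smooth_on (V \<times> (UNIV :: (real \<times> real) set)) (\<lambda>p. matrix (fd f (fst p)))"
    using assms(2) by (intro smooth_on_compose_linear[OF oV bounded_linear_fst mat]) auto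
  have J: "smooth_on (V \<times> UNIV) J"
    unfolding J_def
    by (intro smooth_on_add smooth_on_scaleR fst smooth_on_const oV
        smooth_on_linear[OF _ bounded_linear_fst] smooth_on_linear[OF _ bounded_linear_snd] smooth_on_ident)
  have eq: "J (u, s, t) *v v = s *\<^sub>R v + t *\<^sub>R fd f u v" if "u \<in> U" for u s t v
    using matrix_vector_mul(2)[OF fd_linear[OF smooth(1) that]]
    by (simp add: J_def matrix_vector_mult_add_rdistrib scaleR_matrix_vector_assoc[symmetric])
  have "smooth_points V Y = (V \<times> UNIV) \<inter> (\<lambda>p. det (J p)) -` (- {0})"
  proof -
    have "smooth_point Y (u, s, t) \<longleftrightarrow> det (J (u, s, t)) \<noteq> 0" if "u \<in> U" for u s t
      unfolding smooth_point_Y[OF that] invertible_det_nz[symmetric] invertible_left_inverse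
        matrix_left_invertible_injective by (simp add: eq[OF that, symmetric])
    then show ?thesis
      unfolding smooth_points_def using assms(2) by auto
  qed
  then show ?thesis
    by (simp only:)
      (intro continuous_open_preimage smooth_on_continuous smooth_on_det smooth_on_vec_nth J oV, auto)
qed

end

text \<open>
  The normal form in which the degenerate case is treated: on \<open>V\<close>, the member \<open>s\<^sub>0 B + t\<^sub>0 N\<close> of the
  pencil of conserved densities has the Hessian of largest rank, and \<open>R\<close> and \<open>Q\<close> describe its kernel
  \<open>K u\<close> as in \<open>local_kernel_inverse\<close>.
\<close>

locale degenerate_pencil = two_conservation_laws U f B A N M
  for U :: "(real^'n::finite) set" and f B A N M +
  fixes V :: "(real^'n) set" and s0 t0 :: real and R :: "real^'n \<Rightarrow> real^'n^'n" and Q :: "real^'n^'n"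
    and b :: "nat \<Rightarrow> real^'n" and k :: nat
  assumes V: "open V" "convex V" "V \<subseteq> U"
    and R: "smooth_on V R" "\<And>u. u \<in> V \<Longrightarrow> R u ** (pencil (u, s0, t0) + Q) = mat 1"
      "\<And>u y. u \<in> V \<Longrightarrow> pencil (u, s0, t0) *v (R u *v (Q *v y)) = 0"
    and frame: "\<And>u. u \<in> V \<Longrightarrow> {x. pencil (u, s0, t0) *v x = 0} = (*v) (R u) ` span (b ` {..<k})"
    and dim_kernel: "\<And>u. u \<in> V \<Longrightarrow> dim {x. pencil (u, s0, t0) *v x = 0} = k"
    and isotropic: "\<And>u v w. u \<in> V \<Longrightarrow> pencil (u, s0, t0) *v v = 0 \<Longrightarrow> pencil (u, s0, t0) *v w = 0 \<Longrightarrow> w \<bullet> (hess B u *v v) = 0"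
      "\<And>u v w. u \<in> V \<Longrightarrow> pencil (u, s0, t0) *v v = 0 \<Longrightarrow> pencil (u, s0, t0) *v w = 0 \<Longrightarrow> w \<bullet> (hess N u *v v) = 0"
begin

definition K :: "real^'n \<Rightarrow> (real^'n) set" where
  "K u = {x. pencil (u, s0, t0) *v x = 0}"

text \<open>The linear space over the projective space filled near its smooth points by the
  generators over the leaf of \<open>u\<close>.\<close>

definition L :: "real^'n \<Rightarrow> 'n hcoords set" where
  "L u = lift u ` (K u \<times> UNIV)"

lemma subspace_K: "subspace (K u)"
  unfolding K_def by (rule subspace_matrix_kernel)

lemma segment_in_V:
  assumes "u \<in> V" "u + v \<in> V" "t \<in> {0..1}"
  shows "u + t *\<^sub>R v \<in> V"
  using convexD_alt[OF V(2) assms(1,2), of t] assms(3) by (simp add: algebra_simps)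

lemma smooth_on_V: "smooth_on V f" "smooth_on V B" "smooth_on V A" "smooth_on V N" "smooth_on V M"
  using smooth smooth_on_subset V(3) by blast+

lemma hess_member: "u \<in> U \<Longrightarrow> hess (\<lambda>x. s0 * B x + t0 * N x) u = pencil (u, s0, t0)"
  by (simp add: hess_linear_combination[OF open_U smooth(2,4)])

lemma K_constant:
  assumes u: "u \<in> V" "u + v \<in> V" and v: "v \<in> K u"
  shows "K (u + v) = K u"
proof -
  have hC: "hess (\<lambda>x. s0 * B x + t0 * N x) x = pencil (x, s0, t0)" if "x \<in> V" for x
    using hess_member that V(3) by blast
  have "{x. hess (\<lambda>x. s0 * B x + t0 * N x) (u + v) *v x = 0} = {x. hess (\<lambda>x. s0 * B x + t0 * N x) u *v x = 0}"
  proof (rule kernel_constant_along_line[OF V(1) _ R(1)])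
    show "smooth_on V (\<lambda>x. s0 * B x + t0 * N x)"
      by (intro smooth_on_add smooth_on_mult smooth_on_const smooth_on_V V)
    show "u + t *\<^sub>R v \<in> V" if "t \<in> {0..1}" for t
      using segment_in_V[OF u that] .
  qed (use v u R(2,3) dim_kernel in \<open>simp_all add: hC K_def\<close>)
  then show ?thesis
    using hC u by (simp add: K_def)
qed

lemma K_constant_segment:
  assumes "u \<in> V" "u + v \<in> V" "v \<in> K u" "t \<in> {0..1}"
  shows "K (u + t *\<^sub>R v) = K u"
  using K_constant[OF assms(1) segment_in_V[OF assms(1,2,4)]] subspace_scale[OF subspace_K assms(3)] by simp

text \<open>By \<open>speed_symmetric\<close>, \<open>?P *v fd f u v\<close> pairs with
  \<open>w\<close> as \<open>?P *v v\<close>, which is zero, pairs with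
  \<open>fd f u w\<close>.\<close>

lemma speed_K:
  assumes u: "u \<in> V" and v: "v \<in> K u"
  shows "fd f u v \<in> K u"
proof -
  have uU: "u \<in> U" using u V(3) by auto
  let ?P = "pencil (u, s0, t0)"
  have P: "?P = s0 *\<^sub>R hess B u + t0 *\<^sub>R hess N u" by simp
  have sym: "transpose ?P = ?P"
    using hess_symmetric[OF open_U _ uU, of "\<lambda>x. s0 * B x + t0 * N x"] hess_member[OF uU]
    by (simp add: smooth_on_add smooth_on_mult smooth_on_const smooth open_U)
  have "(?P *v w) \<bullet> fd f u v = (?P *v v) \<bullet> fd f u w" for w
    unfolding P
    using speed_symmetric[OF smooth(2,3) laws(1) uU, of w v] speed_symmetric[OF smooth(4,5) laws(2) uU, of w v]
    by (simp add: matrix_vector_mult_add_rdistrib scaleR_matrix_vector_assoc[symmetric] inner_add_left)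
  then have "(?P *v w) \<bullet> fd f u v = 0" for w
    using v by (simp add: K_def)
  then have "w \<bullet> (?P *v fd f u v) = 0" for w
    unfolding symmetric_matrix_inner[OF sym] .
  then have "?P *v fd f u v = 0"
    using inner_eq_zero_iff by blast
  then show ?thesis by (simp add: K_def)
qed

text \<open>The derivative of \<open>f\<close> along the leaf lies in \<open>K\<close>, which is
  constant there; integration keeps the increment in \<open>K u\<close>.\<close>

lemma flux_K:
  assumes "u \<in> V" "u + v \<in> V" "v \<in> K u"
  shows "f (u + v) - f u \<in> K u"
proof -
  have "pencil (u, s0, t0) *v (f (u + v) - f u) = pencil (u, s0, t0) *v 0"
  proof (rule increment_on_segment[OF smooth_on_V(1)])
    show "bounded_linear ((*v) (pencil (u, s0, t0)))" by (rule matrix_vector_mul_bounded_linear)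
    fix t :: real assume t: "t \<in> {0..1}"
    show "u + t *\<^sub>R v \<in> V" by (rule segment_in_V[OF assms(1,2) t])
    have "v \<in> K (u + t *\<^sub>R v)"
      using assms(3) K_constant_segment[OF assms t] by simp
    from speed_K[OF segment_in_V[OF assms(1,2) t] this] have "fd f (u + t *\<^sub>R v) v \<in> K u"
      using K_constant_segment[OF assms t] by simp
    then show "pencil (u, s0, t0) *v fd f (u + t *\<^sub>R v) v = pencil (u, s0, t0) *v 0"
      by (simp add: K_def)
  qed
  then show ?thesis by (simp add: K_def)
qed

text \<open>Isotropy makes the gradient constant along the leaf when tested on \<open>K u\<close>.
  Integrating gives the claim for \<open>g\<close>, and for \<open>h\<close> because
  \<open>df\<close> maps \<open>v\<close> into \<open>K u\<close>.\<close>

lemma law_affine_on_leaf: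
  assumes u: "u \<in> V" "u + v \<in> V" and v: "v \<in> K u"
    and g: "smooth_on U g" and h: "smooth_on U h" "conservation_law U f g h"
    and iso: "\<forall>u\<in>V. \<forall>v\<in>K u. \<forall>w\<in>K u. w \<bullet> (hess g u *v v) = 0"
  shows "w \<in> K u \<Longrightarrow> grad g (u + v) \<bullet> w = grad g u \<bullet> w"
    and "g (u + v) - g u = grad g u \<bullet> v"
    and "h (u + v) - h u = grad g u \<bullet> (f (u + v) - f u)"
proof -
  have seg: "u + t *\<^sub>R v \<in> V" "u + t *\<^sub>R v \<in> U" "K (u + t *\<^sub>R v) = K u" if "t \<in> {0..1}" for t
    using segment_in_V[OF u that] K_constant_segment[OF u v that] V(3) by auto
  \<comment> \<open>Stated for any leaf vector \<open>y\<close>, so that it also applies at the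
    intermediate points of the segment.\<close>
  have grad: "grad g (u + y) \<bullet> w = grad g u \<bullet> w" if w: "w \<in> K u" and y: "u + y \<in> V" "y \<in> K u" for w y
  proof -
    have "(grad g (u + y) - grad g u) \<bullet> w = 0 \<bullet> w"
    proof (rule increment_on_segment[OF smooth_on_grad[OF open_U g]])
      show "bounded_linear (\<lambda>x. x \<bullet> w)" by (rule bounded_linear_inner_left)
      fix t :: real assume t: "t \<in> {0..1}"
      have V': "u + t *\<^sub>R y \<in> V" by (rule segment_in_V[OF u(1) y(1) t])
      then show U': "u + t *\<^sub>R y \<in> U" using V(3) by auto
      have "w \<bullet> (hess g (u + t *\<^sub>R y) *v y) = 0"
        using iso V' K_constant_segment[OF u(1) y t] w y(2) by blast
      then show "fd (grad g) (u + t *\<^sub>R y) y \<bullet> w = 0 \<bullet> w"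
        by (simp add: hess_mult[OF open_U g U'] inner_commute)
    qed
    then show ?thesis by (simp add: inner_diff_left)
  qed
  have gradt: "grad g (u + t *\<^sub>R v) \<bullet> w = grad g u \<bullet> w" if "w \<in> K u" "t \<in> {0..1}" for w t
    using grad[OF that(1) seg(1)[OF that(2)]] subspace_scale[OF subspace_K v] by simp
  show "grad g (u + v) \<bullet> w = grad g u \<bullet> w" if "w \<in> K u"
    using gradt[OF that, of 1] by simp
  have "(g (u + v) - g u) = grad g u \<bullet> v"
  proof (rule increment_on_segment[OF g, where l = "\<lambda>x. x"])
    fix t :: real assume t: "t \<in> {0..1}"
    show "u + t *\<^sub>R v \<in> U" "fd g (u + t *\<^sub>R v) v = grad g u \<bullet> v"
      using seg[OF t] gradt[OF v t] by (simp_all add: fd_eq_grad[OF g])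
  qed (rule bounded_linear_ident)
  then show "g (u + v) - g u = grad g u \<bullet> v" .
  \<comment> \<open>The gradient is frozen at \<open>u\<close>, so the difference has zero
    derivative along the segment.\<close>
  have "(\<lambda>x. h x - grad g u \<bullet> f x) (u + v) - (\<lambda>x. h x - grad g u \<bullet> f x) u = 0"
  proof (rule increment_on_segment[where l = "\<lambda>x. x" and S = U])
    show "smooth_on U (\<lambda>x. h x - grad g u \<bullet> f x)"
      by (intro smooth_on_diff smooth_on_inner smooth_on_const smooth open_U h)
    fix t :: real assume t: "t \<in> {0..1}"
    show U': "u + t *\<^sub>R v \<in> U" using seg[OF t] by simp
    have "((\<lambda>x. h x - grad g u \<bullet> f x) has_derivative
        (\<lambda>w. fd h (u + t *\<^sub>R v) w - grad g u \<bullet> fd f (u + t *\<^sub>R v) w)) (at (u + t *\<^sub>R v))"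
      by (intro has_derivative_diff has_derivative_inner_right smooth_on_has_derivative[OF _ U'] h smooth)
    then have "fd (\<lambda>x. h x - grad g u \<bullet> f x) (u + t *\<^sub>R v) v
      = grad g (u + t *\<^sub>R v) \<bullet> fd f (u + t *\<^sub>R v) v - grad g u \<bullet> fd f (u + t *\<^sub>R v) v"
      by (simp add: fd_eq conservation_law_fd[OF smooth(1) g h U'])
    also have "fd f (u + t *\<^sub>R v) v \<in> K u"
      using speed_K[OF seg(1)[OF t]] v seg(3)[OF t] by simp
    then have "grad g (u + t *\<^sub>R v) \<bullet> fd f (u + t *\<^sub>R v) v - grad g u \<bullet> fd f (u + t *\<^sub>R v) v = 0"
      using gradt[OF _ t] by simp
    finally show "fd (\<lambda>x. h x - grad g u \<bullet> f x) (u + t *\<^sub>R v) v = 0" .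
  qed (rule bounded_linear_ident)
  then show "h (u + v) - h u = grad g u \<bullet> (f (u + v) - f u)"
    by (simp add: inner_diff_right)
qed

text \<open>As the laws are affine along the leaf, moving the base point only shifts the kernel
  component. For \<open>w = 0\<close> this puts the generator of \<open>u + v\<close> into
  \<open>L u\<close>.\<close>

lemma lift_on_leaf:
  assumes u: "u \<in> V" "u + v \<in> V" and v: "v \<in> K u" and w: "w \<in> K u"
  shows "lift (u + v) (w, s, t) = lift u (w + (s *\<^sub>R v + t *\<^sub>R (f (u + v) - f u)), s, t)"
proof -
  have isoB: "\<forall>u\<in>V. \<forall>v\<in>K u. \<forall>w\<in>K u. w \<bullet> (hess B u *v v) = 0"
    and isoN: "\<forall>u\<in>V. \<forall>v\<in>K u. \<forall>w\<in>K u. w \<bullet> (hess N u *v v) = 0"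
    using isotropic unfolding K_def by blast+
  note affB = law_affine_on_leaf[OF u v smooth(2,3) laws(1) isoB]
  note affN = law_affine_on_leaf[OF u v smooth(4,5) laws(2) isoN]
  have eqs: "B (u + v) = B u + grad B u \<bullet> v" "N (u + v) = N u + grad N u \<bullet> v"
    "A (u + v) = A u + grad B u \<bullet> (f (u + v) - f u)" "M (u + v) = M u + grad N u \<bullet> (f (u + v) - f u)"
    using affB(2,3) affN(2,3) by linarith+
  then show ?thesis
    by (simp add: lift_def eqs affB(1)[OF w] affN(1)[OF w] algebra_simps)
qed

section \<open>The projective spaces attached to the leaves\<close>

lemma L_constant:
  assumes u: "u \<in> V" "u + v \<in> V" and v: "v \<in> K u"
  shows "L (u + v) = L u"
proof -
  have sub: "L (u + v) \<subseteq> L u" if u: "u \<in> V" "u + v \<in> V" and v: "v \<in> K u" for u v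
  proof -
    have "lift (u + v) (w, s, t) \<in> L u" if "w \<in> K u" for w s t
      unfolding lift_on_leaf[OF u v that] L_def
      by (intro imageI) (auto intro!: subspace_add subspace_scale subspace_K that v flux_K[OF u v])
    then show ?thesis
      unfolding L_def K_constant[OF u v] by auto
  qed
  \<comment> \<open>The same inclusion, started at \<open>u + v\<close> and moved back by
    \<open>- v\<close>.\<close>
  have "L u \<subseteq> L (u + v)"
    using sub[of "u + v" "- v"] u K_constant[OF u v] subspace_neg[OF subspace_K v] by simp
  with sub[OF u v] show ?thesis by blast
qed

lemma subspace_L: "subspace (L u)"
  unfolding L_def by (intro linear_subspace_image linear_lift subspace_Times subspace_K subspace_UNIV)

lemma dim_L: "u \<in> V \<Longrightarrow> dim (L u) = k + 2"
proof -
  assume u: "u \<in> V"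
  have "dim (L u) = dim (K u \<times> (UNIV :: (real \<times> real) set))"
    unfolding L_def by (intro dim_image_eq linear_lift inj_on_subset[OF inj_lift]) auto
  also have "\<dots> = k + 2"
    using dim_kernel[OF u] unfolding K_def[symmetric] by (simp add: dim_Times subspace_K)
  finally show ?thesis .
qed

text \<open>Indices 0 and 1 span the generator, and the \<open>k\<close> kernel vectors follow with
  a shift by 2, so \<open>{..k + 1}\<close> lists \<open>k + 2\<close> vectors.\<close>

definition L_frame :: "nat \<Rightarrow> (real^'n) \<times> real \<times> real \<Rightarrow> 'n hcoords" where
  "L_frame j p = (if j = 0 then lift (fst p) (0, 1, 0) else if j = 1 then lift (fst p) (0, 0, 1)
     else lift (fst p) (R (fst p) *v b (j - 2), 0, 0))"

lemma smooth_on_L_frame: "smooth_on (V \<times> UNIV) (L_frame j)"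
proof -
  have oV: "open (V \<times> (UNIV :: (real \<times> real) set))"
    by (intro open_Times V) auto
  have lift: "smooth_on (V \<times> (UNIV :: (real \<times> real) set)) (\<lambda>p. lift (fst p) (y (fst p), s, t))"
    if y: "smooth_on V y" for y and s t :: real
  proof (rule smooth_on_compose_linear[OF oV bounded_linear_fst])
    show "smooth_on V (\<lambda>u. lift u (y u, s, t))"
      unfolding lift_def prod.case
      by (intro smooth_on_Pair smooth_on_add smooth_on_mult smooth_on_scaleR smooth_on_inner smooth_on_const
          smooth_on_ident smooth_on_grad smooth_on_V y V)
  qed auto
  have "L_frame j = (if j = 0 then (\<lambda>p. lift (fst p) (0, 1, 0)) else if j = 1 then (\<lambda>p. lift (fst p) (0, 0, 1))
     else (\<lambda>p. lift (fst p) (R (fst p) *v b (j - 2), 0, 0)))"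
    by (auto simp: L_frame_def)
  then show ?thesis
    using lift[OF smooth_on_const] lift[OF smooth_on_matrix_vector[OF V(1) R(1) smooth_on_const]] by simp
qed

lemma span_L_frame:
  assumes u: "u \<in> V"
  shows "L u = span ((\<lambda>j. L_frame j (u, y)) ` {..k + 1})"
proof
  have Kspan: "K u = span ((\<lambda>j. R u *v b j) ` {..<k})"
    unfolding K_def frame[OF u] linear_span_image[OF matrix_vector_mul_linear, symmetric]
    by (simp add: image_image)
  have "L_frame j (u, y) \<in> L u" if "j \<in> {..k + 1}" for j
  proof -
    have "R u *v b (j - 2) \<in> K u" if "2 \<le> j"
      unfolding Kspan using that \<open>j \<in> {..k + 1}\<close> by (intro span_base imageI) auto
    moreover have "j = 0 \<or> j = 1 \<or> 2 \<le> j" by linarith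
    ultimately show ?thesis
      by (auto simp: L_frame_def L_def intro!: imageI subspace_0 subspace_K)
  qed
  then show "span ((\<lambda>j. L_frame j (u, y)) ` {..k + 1}) \<subseteq> L u"
    by (intro span_minimal subspace_L) auto
  let ?S = "span ((\<lambda>j. L_frame j (u, y)) ` {..k + 1})"
  have lin: "linear (\<lambda>w. lift u (w, 0, 0))"
    by (auto simp: linear_iff lift_def inner_add_right)
  have kernel: "lift u (w, 0, 0) \<in> ?S" if "w \<in> K u" for w
  proof -
    have "lift u (w, 0, 0) \<in> span ((\<lambda>w. lift u (w, 0, 0)) ` (\<lambda>j. R u *v b j) ` {..<k})"
      using that unfolding Kspan linear_span_image[OF lin] by blast
    also have "\<dots> \<subseteq> ?S"
    proof (intro span_mono image_subsetI)
      fix w assume "w \<in> (\<lambda>j. R u *v b j) ` {..<k}"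
      then obtain j where "j < k" "w = R u *v b j" by auto
      then show "lift u (w, 0, 0) \<in> (\<lambda>j. L_frame j (u, y)) ` {..k + 1}"
        by (intro image_eqI[of _ _ "j + 2"]) (auto simp: L_frame_def)
    qed
    finally show ?thesis .
  qed
  have e0: "lift u (0, 1, 0) \<in> ?S"
    by (intro span_base image_eqI[of _ _ 0]) (auto simp: L_frame_def)
  have e1: "lift u (0, 0, 1) \<in> ?S"
    by (intro span_base image_eqI[of _ _ 1]) (auto simp: L_frame_def)
  have "lift u (w, s, t) \<in> ?S" if "w \<in> K u" for w s t
  proof -
    have "lift u (w, s, t) = s *\<^sub>R lift u (0, 1, 0) + t *\<^sub>R lift u (0, 0, 1) + lift u (w, 0, 0)"
      by (simp add: lift_def)
    then show ?thesis
      using e0 e1 kernel[OF that] by (simp add: span_add span_scale)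
  qed
  then show "L u \<subseteq> ?S" unfolding L_def by auto
qed

end

context degenerate_pencil
begin

text \<open>
  The points of \<open>L u\<close> near \<open>Y (u, s, t)\<close> are points of the hypersurface: one has to solve
  \<open>s' v + t' (f (u + v) - f u) = w\<close> for \<open>v\<close> in the kernel \<open>K u\<close>. With a projection \<open>P\<close> onto \<open>K u\<close>, the
  map \<open>\<Psi>\<close> below extends this equation to all \<open>v\<close>, and its derivative is invertible.
\<close>

lemma L_locally_in_hypersurface:
  assumes u: "u \<in> V" and p: "smooth_point Y (u, s, t)"
  obtains G where "open G" "Y (u, s, t) \<in> G"
    "\<forall>y \<in> G \<inter> L u. \<exists>q \<in> smooth_points V Y. Y q = y \<and> L (fst q) = L u"
proof -
  have uU: "u \<in> U" using u V(3) by auto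
  \<comment> \<open>\<open>P\<close> is a projection: its values are kernel vectors by
    \<open>R(3)\<close>, and on the kernel \<open>pencil + Q\<close> reduces to \<open>Q\<close>,
    which \<open>R u\<close> inverts.\<close>
  define P where "P w = R u *v (Q *v w)" for w
  have linP: "linear P"
    unfolding P_def by (auto simp: linear_iff matrix_vector_right_distrib matrix_vector_mult_scaleR)
  have PK: "P w \<in> K u" for w
    using R(3)[OF u] unfolding P_def K_def by simp
  have P_id: "P w = w" if "w \<in> K u" for w
  proof -
    have "R u *v ((pencil (u, s0, t0) + Q) *v w) = w"
      using R(2)[OF u] by (simp add: matrix_vector_mul_assoc)
    then show ?thesis
      using that unfolding matrix_vector_mult_add_rdistrib P_def K_def by simp
  qed
  have cancel: "P (x + (v - P v)) = x" if "x \<in> K u" for x v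
    by (simp only: linear_add[OF linP] linear_diff[OF linP] P_id[OF that] P_id[OF PK] diff_self add_0_right)
  have blP: "bounded_linear P" using linP linear_conv_bounded_linear by blast
  interpret P: bounded_linear P by fact
  \<comment> \<open>The summand \<open>v - P v\<close> fills a complement of \<open>K u\<close> and
    is annihilated by \<open>P\<close>.\<close>
  define \<Psi> where "\<Psi> = (\<lambda>(v, a, b). (P (a *\<^sub>R P v + b *\<^sub>R (f (u + P v) - f u)) + (v - P v), a, b))"
  define T where "T = (\<lambda>(v, a, b). (u + P v, a, b)) -` smooth_points V Y"
  have contT: "continuous_on UNIV (\<lambda>(v, a, b). (u + P v, a, b) :: (real^'n) \<times> real \<times> real)"
    unfolding case_prod_unfold by (intro continuous_intros P.continuous_on)
  have oT: "open T"
    unfolding T_def using open_smooth_points_Y[OF V(1,3)] by (rule open_vimage[OF _ contT])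
  have pT: "(0, s, t) \<in> T"
    using u p by (simp add: T_def smooth_points_def P.zero)
  have contf: "continuous_on T (\<lambda>p. f (u + P (fst p)))"
    by (rule continuous_on_compose2[OF smooth_on_continuous[OF smooth_on_V(1)]])
      (auto intro!: continuous_intros P.continuous_on simp: T_def smooth_points_def)
  have cont: "continuous_on T \<Psi>"
    unfolding \<Psi>_def case_prod_unfold
    by (intro continuous_intros P.continuous_on contf)
  define D where "D = (\<lambda>(v, a, b). (P (s *\<^sub>R P v + t *\<^sub>R fd f u (P v)) + (v - P v), a, b) :: (real^'n) \<times> real \<times> real)"
  have D: "(\<Psi> has_derivative D) (at (0, s, t))"
  proof -
    have "((\<lambda>p. u + P (fst p)) has_derivative (\<lambda>h. P (fst h))) (at (0, s, t))"
      by (auto intro!: derivative_eq_intros P.has_derivative)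
    from has_derivative_compose[OF this, of f "fd f u"]
    have [derivative_intros]: "((\<lambda>p. f (u + P (fst p))) has_derivative (\<lambda>h. fd f u (P (fst h)))) (at (0, s, t))"
      using smooth_on_has_derivative[OF smooth(1) uU] by (simp add: P.zero)
    note [derivative_intros] = P.has_derivative
    show ?thesis
      unfolding \<Psi>_def case_prod_unfold
      by (rule derivative_eq_intros refl)+
        (auto simp: D_def fun_eq_iff P.zero P.add P.diff P.scaleR)
  qed
  have linD: "linear D" using D has_derivative_linear by blast
  \<comment> \<open>Applying \<open>P\<close> isolates \<open>s du + t df = 0\<close> for
    \<open>du = P v\<close>; smoothness of the point gives \<open>P v = 0\<close>, and the
    complement part then gives \<open>v = 0\<close>.\<close>
  have "D x = 0 \<Longrightarrow> x = 0" for x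
  proof -
    obtain v a b where x: "x = (v, a, b)" by (metis prod.collapse)
    assume "D x = 0"
    then have ab: "a = 0" "b = 0" and eq: "P (s *\<^sub>R P v + t *\<^sub>R fd f u (P v)) + (v - P v) = 0"
      by (auto simp: D_def x zero_prod_def)
    have mem: "s *\<^sub>R P v + t *\<^sub>R fd f u (P v) \<in> K u"
      by (intro subspace_add subspace_scale subspace_K PK speed_K u)
    have "s *\<^sub>R P v + t *\<^sub>R fd f u (P v) = 0"
      using cancel[OF mem, of v] eq by (simp only: P_id[OF mem] P.zero)
    moreover have "s *\<^sub>R 0 + t *\<^sub>R fd f u 0 = 0"
      by (simp add: linear_0[OF fd_linear[OF smooth(1) uU]])
    ultimately have "P v = 0"
      using p unfolding smooth_point_Y[OF uU] inj_def by metis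
    then show "x = 0"
      using eq ab by (simp add: x zero_prod_def P.zero linear_0[OF fd_linear[OF smooth(1) uU]])
  qed
  then have "inj D" using linear_injective_0[OF linD] by blast
  then obtain D' where D': "linear D'" "\<And>x. D (D' x) = x"
    using linear_injective_isomorphism[OF linD] by auto
  \<comment> \<open>As \<open>D\<close> has the right inverse \<open>D'\<close>, the image of
    \<open>T\<close> is a neighbourhood of the image point.\<close>
  have int: "\<Psi> (0, s, t) \<in> interior (\<Psi> ` T)"
    using D' oT pT
    by (intro sussmann_open_mapping[OF oT cont pT D, of D']) (auto simp: linear_conv_bounded_linear interior_open)
  \<comment> \<open>A continuous left inverse of \<open>lift u\<close> on the whole space, which
    pulls this neighbourhood back to an open set of ambient vectors.\<close>
  define unlift :: "'n hcoords \<Rightarrow> (real^'n) \<times> real \<times> real"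
    where "unlift = (\<lambda>(y0, y1, b, c, y3). (y1 - y0 *\<^sub>R u - y3 *\<^sub>R f u, y0, y3))"
  have unlift: "unlift (lift u z) = z" for z
    by (cases z) (simp add: unlift_def lift_def)
  have cont_unlift: "continuous_on UNIV unlift"
    unfolding unlift_def case_prod_unfold by (intro continuous_intros)
  show ?thesis
  proof (rule that[of "unlift -` interior (\<Psi> ` T)"])
    show "open (unlift -` interior (\<Psi> ` T))"
      by (rule open_vimage[OF open_interior cont_unlift])
    show "Y (u, s, t) \<in> unlift -` interior (\<Psi> ` T)"
      using int by (simp add: Y_eq_lift unlift \<Psi>_def P.zero)
    show "\<forall>y \<in> unlift -` interior (\<Psi> ` T) \<inter> L u. \<exists>q \<in> smooth_points V Y. Y q = y \<and> L (fst q) = L u"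
    proof
      fix y assume "y \<in> unlift -` interior (\<Psi> ` T) \<inter> L u"
      then have y: "y \<in> unlift -` interior (\<Psi> ` T)" "y \<in> L u" by auto
      then obtain w a b where w: "w \<in> K u" "y = lift u (w, a, b)"
        unfolding L_def by auto
      then have "(w, a, b) \<in> \<Psi> ` T"
        using y(1) interior_subset by (auto simp: unlift)
      then obtain v where v: "(v, a, b) \<in> T" and eq: "P (a *\<^sub>R P v + b *\<^sub>R (f (u + P v) - f u)) + (v - P v) = w"
        by (auto simp: \<Psi>_def)
      have q: "(u + P v, a, b) \<in> smooth_points V Y" using v by (simp add: T_def)
      then have uV: "u + P v \<in> V" by (simp add: smooth_points_def)
      have mem: "a *\<^sub>R P v + b *\<^sub>R (f (u + P v) - f u) \<in> K u"
        by (intro subspace_add subspace_scale subspace_K PK flux_K u uV)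
      \<comment> \<open>Since \<open>w\<close> lies in \<open>K u\<close>, applying \<open>P\<close>
        to \<open>eq\<close> drops the complement part.\<close>
      have "w = a *\<^sub>R P v + b *\<^sub>R (f (u + P v) - f u)"
        using cancel[OF mem, of v] eq P_id[OF w(1)] by (simp only: P_id[OF mem])
      then have "Y (u + P v, a, b) = y"
        using lift_on_leaf[OF u uV PK subspace_0[OF subspace_K]] by (simp add: w(2) Y_eq_lift)
      then show "\<exists>q \<in> smooth_points V Y. Y q = y \<and> L (fst q) = L u"
        using q L_constant[OF u uV PK] by force
    qed
  qed
qed

text \<open>Linear dimension \<open>k + 2\<close> is projective dimension \<open>k + 1\<close>. The
  frame is smooth over all of \<open>V\<close>, so no smaller neighbourhood is chosen for
  it.\<close>

lemma ruled_by_leaves: "ruled_by_projective_spaces (k + 1) V Y"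
  unfolding ruled_by_projective_spaces_def
proof (intro exI[of _ "\<lambda>p. L (fst p)"] ballI conjI)
  fix p assume p: "p \<in> smooth_points V Y"
  obtain u s t where ust: "p = (u, s, t)" by (metis prod.collapse)
  have u: "u \<in> V" and sp: "smooth_point Y (u, s, t)" using p by (auto simp: ust smooth_points_def)
  show "subspace (L (fst p))" by (rule subspace_L)
  show "dim (L (fst p)) = k + 1 + 1" using dim_L[OF u] by (simp add: ust)
  show "Y p \<in> L (fst p)"
    by (auto simp: ust Y_eq_lift L_def intro!: imageI subspace_0 subspace_K)
  show "\<exists>G e. open G \<and> p \<in> G \<and> (\<forall>j\<le>k + 1. smooth_on (G \<inter> smooth_points V Y) (e j))
      \<and> (\<forall>q \<in> G \<inter> smooth_points V Y. L (fst q) = span ((\<lambda>j. e j q) ` {..k + 1}))"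
  proof (intro exI[of _ UNIV] exI[of _ L_frame] conjI allI impI ballI)
    show "smooth_on (UNIV \<inter> smooth_points V Y) (L_frame j)" for j
      by (rule smooth_on_subset[OF smooth_on_L_frame]) (auto simp: smooth_points_def)
    fix q assume "q \<in> UNIV \<inter> smooth_points V Y"
    then have "fst q \<in> V" by (auto simp: smooth_points_def)
    from span_L_frame[OF this, of "snd q"] show "L (fst q) = span ((\<lambda>j. L_frame j q) ` {..k + 1})"
      by simp
  qed auto
  obtain G where G: "open G" "Y (u, s, t) \<in> G"
    "\<forall>y \<in> G \<inter> L u. \<exists>q \<in> smooth_points V Y. Y q = y \<and> L (fst q) = L u"
    by (rule L_locally_in_hypersurface[OF u sp])
  then show "\<exists>G. open G \<and> Y p \<in> G \<and> (\<forall>y \<in> G \<inter> L (fst p). \<exists>q \<in> smooth_points V Y. Y q = y \<and> L (fst q) = L (fst p))"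
    unfolding ust by auto
qed

end

section \<open>From an open set of singular Hessians to a ruling\<close>

context two_conservation_laws
begin

lemma degenerate_dual_imp_ruled:
  assumes G: "open G" "G \<noteq> {}" "G \<subseteq> U \<times> UNIV" and sing: "\<And>p. p \<in> G \<Longrightarrow> \<not> inj ((*v) (pencil p))"
  obtains V r where "open V" "V \<noteq> {}" "V \<subseteq> U" "r > 1" "ruled_by_projective_spaces r V Y"
proof -
  define k where "k p = dim {x. pencil p *v x = 0}" for p
  \<comment> \<open>The rank is largest among all of \<open>G\<close>, hence also under changes of
    \<open>s\<close> and \<open>t\<close>.\<close>
  obtain p0 where p0: "p0 \<in> G" "\<And>p. p \<in> G \<Longrightarrow> k p0 \<le> k p"
    using ex_has_least_nat[of "\<lambda>p. p \<in> G" _ k] G(2) by blast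
  obtain u0 s0 t0 where ust: "p0 = (u0, s0, t0)" by (metis prod.collapse)
  define G1 where "G1 = (\<lambda>u. (u, s0, t0)) -` G"
  have G1: "open G1" "u0 \<in> G1" "G1 \<subseteq> U"
    using G p0(1) unfolding G1_def ust by (auto intro!: open_vimage continuous_intros)
  have smH: "smooth_on G1 (\<lambda>u. pencil (u, s0, t0))"
    using G1(3)
    by (auto intro!: smooth_on_add smooth_on_scaleR smooth_on_const G1(1) intro: smooth_on_subset[OF smooth_on_hess[OF open_U]] smooth)
  have hessB: "transpose (hess B u) = hess B u" "transpose (hess N u) = hess N u" if "u \<in> U" for u
    using hess_symmetric[OF open_U _ that] smooth by auto
  have sym: "transpose (pencil p) = pencil p" if "fst p \<in> U" for p
    using hessB[OF that] by (simp add: transpose_def vec_eq_iff)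
  obtain G2 R Q where G2: "open G2" "u0 \<in> G2" "G2 \<subseteq> G1" "smooth_on G2 R"
    "\<forall>u\<in>G2. R u ** (pencil (u, s0, t0) + Q) = mat 1"
    "\<forall>u\<in>G2. \<forall>y. pencil (u, s0, t0) *v (R u *v (Q *v y)) = 0"
    "\<forall>u\<in>G2. {x. pencil (u, s0, t0) *v x = 0} = (*v) (R u) ` {x. pencil (u0, s0, t0) *v x = 0}"
    "\<forall>u\<in>G2. dim {x. pencil (u, s0, t0) *v x = 0} = dim {x. pencil (u0, s0, t0) *v x = 0}"
  proof (rule local_kernel_inverse[OF G1(1) smH G1(2)])
    show "transpose (pencil (u0, s0, t0)) = pencil (u0, s0, t0)"
      using G1 by (intro sym) auto
    show "dim {x. pencil (u0, s0, t0) *v x = 0} \<le> dim {x. pencil (u, s0, t0) *v x = 0}" if "u \<in> G1" for u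
      using p0(2)[of "(u, s0, t0)"] that unfolding k_def ust G1_def by auto
  qed
  \<comment> \<open>A ball, since the leaf argument needs a convex base.\<close>
  obtain e where e: "e > 0" "ball u0 e \<subseteq> G2"
    using G2(1,2) open_contains_ball by blast
  obtain E where E: "independent E" "span E = {x. pencil p0 *v x = 0}" "card E = k p0"
    using orthonormal_basis_subspace[OF subspace_matrix_kernel[of "pencil p0"]] unfolding k_def by metis
  obtain b where b: "b ` {..<k p0} = E"
    using ex_bij_betw_nat_finite[OF independent_imp_finite[OF E(1)]] E(3)
    unfolding bij_betw_def lessThan_atLeast0 by metis
  have "ball u0 e \<subseteq> G1" using e(2) G2(3) by blast
  then have in_G: "(u, s0, t0) \<in> G" "u \<in> U" if "u \<in> ball u0 e" for u
    using that G1(3) unfolding G1_def by blast+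
  \<comment> \<open>Extremality over \<open>G\<close> allows derivatives in every direction
    \<open>d\<close>; along \<open>s\<close> and \<open>t\<close> they are the Hessians of
    \<open>B\<close> and \<open>N\<close>, which yields the isotropy.\<close>
  have iso: "w \<bullet> (fd pencil (u, s0, t0) d *v v) = 0"
    if u: "u \<in> ball u0 e" and vw: "pencil (u, s0, t0) *v v = 0" "pencil (u, s0, t0) *v w = 0" for u v w d
  proof (rule kernel_derivative_zero[OF G(1) smooth_on_pencil[OF G(1,3)] in_G(1)[OF u] sym _ vw])
    fix p assume p: "p \<in> G"
    have "dim {x. pencil (u, s0, t0) *v x = 0} = k p0"
      using G2(8) u e(2) unfolding k_def ust by blast
    then show "dim {x. pencil (u, s0, t0) *v x = 0} \<le> dim {x. pencil p *v x = 0}"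
      using p0(2)[OF p] unfolding k_def by simp
  qed (use in_G(2)[OF u] in simp)
  have dir: "fd pencil (u, s0, t0) (0, 1, 0) = hess B u" "fd pencil (u, s0, t0) (0, 0, 1) = hess N u" if "u \<in> U" for u
  proof -
    note [derivative_intros] = has_derivative_comp_fst[OF smooth_on_hess[OF open_U smooth(2)] that]
      has_derivative_comp_fst[OF smooth_on_hess[OF open_U smooth(4)] that]
    have "(pencil has_derivative (\<lambda>h. s0 *\<^sub>R fd (hess B) u (fst h) + fst (snd h) *\<^sub>R hess B u
        + (t0 *\<^sub>R fd (hess N) u (fst h) + snd (snd h) *\<^sub>R hess N u))) (at (u, s0, t0))"
      by (rule derivative_eq_intros refl)+ auto
    then have "fd pencil (u, s0, t0) h = s0 *\<^sub>R fd (hess B) u (fst h) + fst (snd h) *\<^sub>R hess B u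
        + (t0 *\<^sub>R fd (hess N) u (fst h) + snd (snd h) *\<^sub>R hess N u)" for h
      by (rule fd_eq)
    then show "fd pencil (u, s0, t0) (0, 1, 0) = hess B u" "fd pencil (u, s0, t0) (0, 0, 1) = hess N u"
      by (simp_all add: linear_0[OF fd_linear[OF smooth_on_hess[OF open_U smooth(2)] that]]
          linear_0[OF fd_linear[OF smooth_on_hess[OF open_U smooth(4)] that]])
  qed
  interpret degenerate_pencil U f B A N M "ball u0 e" s0 t0 R Q b "k p0"
  proof
    show "smooth_on (ball u0 e) R" by (rule smooth_on_subset[OF G2(4) e(2)])
    fix u assume u: "u \<in> ball u0 e"
    then have u2: "u \<in> G2" using e(2) by blast
    show "R u ** (pencil (u, s0, t0) + Q) = mat 1" "pencil (u, s0, t0) *v (R u *v (Q *v y)) = 0" for y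
      using G2(5,6) u2 by blast+
    show "{x. pencil (u, s0, t0) *v x = 0} = (*v) (R u) ` span (b ` {..<k p0})"
    proof -
      have "span (b ` {..<k p0}) = {x. pencil (u0, s0, t0) *v x = 0}"
        unfolding b E(2) by (simp only: ust)
      then show ?thesis using G2(7) u2 by simp
    qed
    show "dim {x. pencil (u, s0, t0) *v x = 0} = k p0"
      using G2(8) u2 unfolding k_def ust by blast
    show "w \<bullet> (hess B u *v v) = 0" "w \<bullet> (hess N u *v v) = 0"
      if "pencil (u, s0, t0) *v v = 0" "pencil (u, s0, t0) *v w = 0" for v w
      using iso[OF u that, of "(0, 1, 0)"] iso[OF u that, of "(0, 0, 1)"] unfolding dir[OF in_G(2)[OF u]] by simp_all
  qed (use in_G in auto)
  obtain x where "x \<noteq> 0" "pencil p0 *v x = 0"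
    using sing[OF p0(1)] linear_injective_0[OF matrix_vector_mul_linear, of "pencil p0"] by blast
  \<comment> \<open>Singularity at \<open>p0\<close> is what makes the ruling dimension
    \<open>k p0 + 1\<close> exceed 1.\<close>
  then have "k p0 \<noteq> 0"
    unfolding k_def dim_eq_0 by blast
  moreover have "ball u0 e \<subseteq> U" using in_G(2) by blast
  ultimately show ?thesis
    using that[of "ball u0 e" "k p0 + 1"] ruled_by_leaves e(1) by auto
qed

text \<open>If smooth points were not dense, the complement of their closure would be a nonempty
  open set of singular Hessians.\<close>

lemma codimension_two_dual:
  assumes "\<And>V r. open V \<Longrightarrow> V \<noteq> {} \<Longrightarrow> V \<subseteq> U \<Longrightarrow> r > 1 \<Longrightarrow> \<not> ruled_by_projective_spaces r V Y"
  shows "codimension_two U (line_sweep X W)"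
proof (rule ccontr)
  assume "\<not> ?thesis"
  then obtain p where p: "p \<in> U \<times> UNIV" "p \<notin> closure (smooth_points U (line_sweep X W))"
    unfolding codimension_two_def by blast
  define G where "G = (U \<times> UNIV) - closure (smooth_points U (line_sweep X W))"
  have "open G" unfolding G_def by (intro open_Diff open_Times open_U) auto
  moreover have "\<not> inj ((*v) (pencil q))" if "q \<in> G" for q
  proof -
    obtain u s t where q: "q = (u, s, t)" by (metis prod.collapse)
    have "u \<in> U" "(u, s, t) \<notin> smooth_points U (line_sweep X W)"
      using that closure_subset unfolding G_def q by blast+
    then show ?thesis
      using smooth_point_dual[of u s t] by (simp add: smooth_points_def q)
  qed
  ultimately obtain V r where "open V" "V \<noteq> {}" "V \<subseteq> U" "r > 1" "ruled_by_projective_spaces r V Y"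
    using p degenerate_dual_imp_ruled[of G] unfolding G_def by blast
  then show False using assms by blast
qed

end

theorem theorem2:
  fixes U :: "(real^'n::finite) set"
    and f :: "real^'n \<Rightarrow> real^'n"
    and B A N M :: "real^'n \<Rightarrow> real"
    and \<Sigma> :: "'n sweep"
  assumes "open U"
    and "smooth_on U f" "smooth_on U B" "smooth_on U A" "smooth_on U N" "smooth_on U M"
    and "conservation_law U f B A" "conservation_law U f N M"
    and "independent_laws U f B A N M"
    and "\<Sigma> = ruled_hypersurface f B A N M"
    and "\<And>V r. open V \<Longrightarrow> V \<noteq> {} \<Longrightarrow> V \<subseteq> U \<Longrightarrow> r > 1 \<Longrightarrow> \<not> ruled_by_projective_spaces r V \<Sigma>"
    and "\<not> tangent_spaces_concurrent U \<Sigma>"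
  shows "(\<exists>X W. dual_generators U \<Sigma> X W
            \<and> codimension_two U (line_sweep X W)
            \<and> stable_along_generators U (line_sweep X W))
         \<and> \<not> (\<exists>H. subspace H \<and> H \<noteq> UNIV \<and> dual_hypersurface U \<Sigma> \<subseteq> H)"
proof -
  interpret two_conservation_laws U f B A N M
    by unfold_locales (fact assms)+
  have "codimension_two U (line_sweep X W)"
    using assms(11) unfolding assms(10) by (rule codimension_two_dual)
  then show ?thesis
    unfolding assms(10)
    using dual_generators_Y stable_dual dual_hypersurface_nondegenerate assms(12)[unfolded assms(10)]
    by blast
qed

end
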